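(* Let $N\ge 1$ and $T\ge 1$ be integers. Let $V:\mathbb{Z}^N\to\mathbb{R}$ and let $f:\mathbb{Z}^N\times\mathbb{R}\to\mathbb{R}$ be such that $u\mapsto f(x,u)$ is continuous for each $x\in\mathbb{Z}^N$, and suppose there are constants $a>0$ and $q>2$ with $|f(x,u)|\le a(|u|+|u|^{q-1})$ for all $x\in\mathbb{Z}^N$, $u\in\mathbb{R}$. Put $F(x,u)=\int_0^u f(x,s)\,ds$. Assume: (i) $V(x)$ and, for every $u\in\mathbb{R}$, $f(x,u)$ are $T$-periodic in $x$, and $V(x)>0$ for all $x\in\mathbb{Z}^N$; (ii) $f(x,u)=o(u)$ uniformly in $x$ as $u\to 0$; (iii) for each $x$, $u\mapsto \frac{f(x,u)}{|u|}$ is strictly increasing on $(-\infty,0)$ and strictly increasing on $(0,+\infty)$; (iv) $\frac{F(x,u)}{u^2}\to\infty$ uniformly in $x$ as $|u|\to\infty$. Then the equation $$-\Delta u+V(x)u=f(x,u)\quad (x\in\mathbb{Z}^N),\qquad u\in H^1(\mathbb{Z}^N),$$ has a ground state solution.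
   Context: $\mathbb{Z}^N$ denotes the standard lattice graph: vertices are the integer points $x=(x_1,\dots,x_N)$, and $x\sim y$ (neighbours) iff $\sum_{i=1}^N|x_i-y_i|=1$. A function $g$ on $\mathbb{Z}^N$ is $T$-periodic if $g(x+Te_i)=g(x)$ for all $x\in\mathbb{Z}^N$ and $1\le i\le N$, where $e_i$ is the $i$-th coordinate unit vector. The Laplacian is $\Delta u(x)=\sum_{y\sim x}(u(y)-u(x))$. $H^1(\mathbb{Z}^N)$ is the completion of the finitely supported functions $C_c(\mathbb{Z}^N)$ under the norm $\|u\|_{H^1}=\big(\frac12\sum_{x}\sum_{y\sim x}(u(y)-u(x))^2+\sum_x u(x)^2\big)^{1/2}$ (which, as the degree is bounded, is equivalent to the $\ell^2$ norm, so $H^1(\mathbb{Z}^N)$ is $\ell^2(\mathbb{Z}^N)$ as a set). The energy functional on $H^1(\mathbb{Z}^N)$ is $$\Phi(u)=\frac12\sum_{x\in\mathbb{Z}^N}\Big(\frac12\sum_{y\sim x}(u(y)-u(x))^2+V(x)u(x)^2\Big)-\sum_{x\in\mathbb{Z}^N}F(x,u(x)).$$ A ground state solution is a solution $u\in H^1(\mathbb{Z}^N)$ of the equation corresponding to the least positive critical value of $\Phi$, i.e. $\Phi'(u)=0$, $\Phi(u)>0$, and $\Phi(u)\le\Phi(v)$ for every $v\in H^1(\mathbb{Z}^N)$ with $\Phi'(v)=0$ and $\Phi(v)>0$. *)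

theory Defs
  imports "HOL-Analysis.Analysis"
begin

section \<open>The lattice graph\<close>

text \<open>
  The vertices of the \<open>N\<close>-dimensional lattice are the elements of \<^typ>\<open>int^'n\<close>, where
  \<open>N = CARD('n)\<close>.  Index types are nonempty, so \<open>N \<ge> 1\<close>.
\<close>

definition nbrs :: "int^'n \<Rightarrow> (int^'n) set" where
  "nbrs x = {y. (\<Sum>i\<in>UNIV. \<bar>x $ i - y $ i\<bar>) = 1}"

definition periodic :: "nat \<Rightarrow> (int^'n \<Rightarrow> 'b) \<Rightarrow> bool" where
  "periodic T g \<longleftrightarrow> (\<forall>x i. g (x + axis i (int T)) = g x)"

definition laplacian :: "(int^'n \<Rightarrow> real) \<Rightarrow> int^'n \<Rightarrow> real" where
  "laplacian u x = (\<Sum>y\<in>nbrs x. u y - u x)"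

lemma nbrs_eq_translate: "nbrs x = (\<lambda>s. x + s) ` nbrs 0" for x :: "int^'n"
proof -
  have "y \<in> (\<lambda>s. x + s) ` nbrs 0" if "y \<in> nbrs x" for y
    using that by (intro image_eqI[of _ _ "y - x"]) (auto simp: nbrs_def abs_minus_commute)
  then show ?thesis by (auto simp: nbrs_def)
qed

lemma finite_nbrs [simp]: "finite (nbrs x)" for x :: "int^'n"
proof -
  have "nbrs 0 \<subseteq> (\<lambda>f. (\<chi> i. f i) :: int^'n) ` (UNIV \<rightarrow>\<^sub>E {-1..1})"
  proof
    fix s :: "int^'n" assume s: "s \<in> nbrs 0"
    have "\<bar>s $ i\<bar> \<le> 1" for i
      using member_le_sum[of i UNIV "\<lambda>i. \<bar>s $ i\<bar>"] s by (simp add: nbrs_def)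
    then have "s $ i \<in> {-1..1}" for i
      by (simp add: abs_le_iff minus_le_iff)
    then show "s \<in> (\<lambda>f. (\<chi> i. f i) :: int^'n) ` (UNIV \<rightarrow>\<^sub>E {-1..1})"
      by (intro image_eqI[of _ _ "\<lambda>i. s $ i"]) (auto simp: vec_eq_iff)
  qed
  then have "finite (nbrs (0 :: int^'n))"
    by (rule finite_subset) (auto intro!: finite_imageI finite_PiE)
  then show ?thesis
    unfolding nbrs_eq_translate[of x] by simp
qed

lemma sum_nbrs: "(\<Sum>y\<in>nbrs x. g y) = (\<Sum>s\<in>nbrs 0. g (x + s))" for x :: "int^'n"
  unfolding nbrs_eq_translate[of x] by (subst sum.reindex) (auto simp: inj_on_def)

lemma has_sum_finite_sum:
  fixes g :: "'b \<Rightarrow> 'a \<Rightarrow> real"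
  assumes "finite I" and "\<And>i. (g i has_sum S i) A"
  shows "((\<lambda>x. \<Sum>i\<in>I. g i x) has_sum (\<Sum>i\<in>I. S i)) A"
  using assms(1) by induction (auto intro!: has_sum_add has_sum_0 assms(2))

lemma has_sum_nbrs:
  fixes g :: "int^'n \<Rightarrow> real"
  assumes "(g has_sum S) UNIV"
  shows "((\<lambda>x. \<Sum>y\<in>nbrs x. g y) has_sum real (card (nbrs (0 :: int^'n))) * S) UNIV"
proof -
  have "((\<lambda>x. g (x + s)) has_sum S) UNIV" for s
    using has_sum_reindex_bij_betw[of "\<lambda>x. x + s" UNIV UNIV g S] assms by (simp add: bij_plus_right)
  then have "((\<lambda>x. \<Sum>s\<in>nbrs 0. g (x + s)) has_sum (\<Sum>s\<in>nbrs (0 :: int^'n). S)) UNIV"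
    by (rule has_sum_finite_sum[OF finite_nbrs])
  then show ?thesis by (simp add: sum_nbrs[where g = g])
qed


section \<open>The space \<open>H\<^sup>1\<close>\<close>

definition grad_sq :: "(int^'n \<Rightarrow> real) \<Rightarrow> int^'n \<Rightarrow> real" where
  "grad_sq u x = (\<Sum>y\<in>nbrs x. (u y - u x)\<^sup>2)"

definition finite_h1_norm :: "(int^'n \<Rightarrow> real) \<Rightarrow> bool" where
  "finite_h1_norm u \<longleftrightarrow> grad_sq u summable_on UNIV \<and> (\<lambda>x. (u x)\<^sup>2) summable_on UNIV"

text \<open>Meaningful only for functions satisfying \<^const>\<open>finite_h1_norm\<close>.\<close>

definition h1_norm :: "(int^'n \<Rightarrow> real) \<Rightarrow> real" where
  "h1_norm u = sqrt (1 / 2 * (\<Sum>\<^sub>\<infinity>x. grad_sq u x) + (\<Sum>\<^sub>\<infinity>x. (u x)\<^sup>2))"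

definition finitely_supported :: "(int^'n \<Rightarrow> real) \<Rightarrow> bool" where
  "finitely_supported u \<longleftrightarrow> finite {x. u x \<noteq> 0}"

text \<open>
  Since \<open>\<bar>u x\<bar> \<le> h1_norm u\<close>, the abstract completion of the finitely supported functions is realised
  by functions, namely by the limits, in the \<open>H\<^sup>1\<close> norm, of sequences of finitely supported
  functions.  Completeness and density are proved below.
\<close>

definition h1_space :: "(int^'n \<Rightarrow> real) set" where
  "h1_space = {u. \<exists>\<phi>. (\<forall>n. finitely_supported (\<phi> n) \<and> finite_h1_norm (\<lambda>x. u x - \<phi> n x)) \<and>
                      (\<lambda>n. h1_norm (\<lambda>x. u x - \<phi> n x)) \<longlonglongrightarrow> 0}"

lemma grad_sq_nonneg: "0 \<le> grad_sq u x"
  by (simp add: grad_sq_def sum_nonneg)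

lemma square_summable_prod:
  fixes u v :: "'a \<Rightarrow> real"
  assumes "(\<lambda>x. (u x)\<^sup>2) summable_on A" "(\<lambda>x. (v x)\<^sup>2) summable_on A"
  shows "(\<lambda>x. u x * v x) summable_on A"
proof -
  have "(\<lambda>x. norm (u x * v x)) summable_on A"
  proof (rule Infinite_Sum.abs_summable_on_comparison_test')
    show "(\<lambda>x. (u x)\<^sup>2 + (v x)\<^sup>2) summable_on A" by (intro summable_on_add assms)
    fix x
    have "0 \<le> (\<bar>u x\<bar> - \<bar>v x\<bar>)\<^sup>2" "0 \<le> (\<bar>u x\<bar> * \<bar>v x\<bar>)" by auto
    then show "norm (u x * v x) \<le> (u x)\<^sup>2 + (v x)\<^sup>2"
      unfolding power2_diff real_norm_def abs_mult power2_abs by linarith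
  qed
  then show ?thesis by (rule abs_summable_summable)
qed

lemma square_summable_add:
  fixes u v :: "'a \<Rightarrow> real"
  assumes "(\<lambda>x. (u x)\<^sup>2) summable_on A" "(\<lambda>x. (v x)\<^sup>2) summable_on A"
  shows "(\<lambda>x. (u x + v x)\<^sup>2) summable_on A"
proof -
  have "(\<lambda>x. (u x)\<^sup>2 + (v x)\<^sup>2 + 2 * (u x * v x)) summable_on A"
    by (intro summable_on_add summable_on_cmult_right square_summable_prod assms)
  then show ?thesis by (simp add: power2_sum mult.assoc)
qed

lemma grad_sq_summable:
  fixes u :: "int^'n \<Rightarrow> real"
  assumes "(\<lambda>x. (u x)\<^sup>2) summable_on UNIV"
  shows "grad_sq u summable_on UNIV"
    and "(\<Sum>\<^sub>\<infinity>x. grad_sq u x) \<le> 4 * real (card (nbrs (0 :: int^'n))) * (\<Sum>\<^sub>\<infinity>x. (u x)\<^sup>2)"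
proof -
  let ?d = "real (card (nbrs (0 :: int^'n)))" and ?S = "\<Sum>\<^sub>\<infinity>x. (u x)\<^sup>2"
  let ?b = "\<lambda>x. 2 * (\<Sum>y\<in>nbrs x. (u y)\<^sup>2) + 2 * (?d * (u x)\<^sup>2)"
  have hs: "((\<lambda>x. (u x)\<^sup>2) has_sum ?S) UNIV" using assms by (rule has_sum_infsum)
  have b: "(?b has_sum (2 * (?d * ?S) + 2 * (?d * ?S))) UNIV"
    by (rule has_sum_add[OF has_sum_cmult_right[OF has_sum_nbrs[OF hs]]
        has_sum_cmult_right[OF has_sum_cmult_right[OF hs]]])
  have le: "grad_sq u x \<le> ?b x" for x
  proof -
    have "(b - a)\<^sup>2 \<le> 2 * b\<^sup>2 + 2 * a\<^sup>2" for a b :: real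
      using zero_le_power2[of "a + b"] unfolding power2_sum power2_diff by (simp add: algebra_simps)
    then have "grad_sq u x \<le> (\<Sum>y\<in>nbrs x. 2 * (u y)\<^sup>2 + 2 * (u x)\<^sup>2)"
      unfolding grad_sq_def by (intro sum_mono)
    also have "\<dots> = 2 * (\<Sum>y\<in>nbrs x. (u y)\<^sup>2) + 2 * (real (card (nbrs x)) * (u x)\<^sup>2)"
      by (simp add: sum.distrib sum_distrib_left)
    also have "card (nbrs x) = card (nbrs (0 :: int^'n))"
      unfolding nbrs_eq_translate[of x] by (rule card_image) (simp add: inj_on_def)
    finally show ?thesis .
  qed
  show *: "grad_sq u summable_on UNIV"
    by (rule summable_on_comparison_test[OF has_sum_imp_summable[OF b]]) (auto simp: le grad_sq_nonneg)
  have "(\<Sum>\<^sub>\<infinity>x. grad_sq u x) \<le> infsum ?b UNIV"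
    by (rule infsum_mono[OF * has_sum_imp_summable[OF b] le])
  also have "infsum ?b UNIV = 4 * ?d * ?S" unfolding infsumI[OF b] by simp
  finally show "(\<Sum>\<^sub>\<infinity>x. grad_sq u x) \<le> 4 * ?d * ?S" .
qed

lemma finite_h1_norm_iff: "finite_h1_norm u \<longleftrightarrow> (\<lambda>x. (u x)\<^sup>2) summable_on UNIV"
  unfolding finite_h1_norm_def by (blast intro: grad_sq_summable(1))

lemma square_summable_finitely_supported:
  assumes "finitely_supported u"
  shows "(\<lambda>x. (u x)\<^sup>2) summable_on UNIV"
  using assms by (intro finite_nonzero_values_imp_summable_on) (simp add: finitely_supported_def)

lemma h1_norm_le:
  fixes u :: "int^'n \<Rightarrow> real"
  assumes "(\<lambda>x. (u x)\<^sup>2) summable_on UNIV"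
  shows "h1_norm u \<le> sqrt ((2 * real (card (nbrs (0 :: int^'n))) + 1) * (\<Sum>\<^sub>\<infinity>x. (u x)\<^sup>2))"
  unfolding h1_norm_def real_sqrt_le_iff using grad_sq_summable(2)[OF assms]
  by (simp add: distrib_right)

lemma h1_norm_nonneg: "0 \<le> h1_norm u"
  unfolding h1_norm_def
  by (intro real_sqrt_ge_zero add_nonneg_nonneg mult_nonneg_nonneg infsum_nonneg grad_sq_nonneg) auto

lemma h1_space_iff: "u \<in> h1_space \<longleftrightarrow> (\<lambda>x. (u x)\<^sup>2) summable_on UNIV"
  for u :: "int^'n \<Rightarrow> real"
proof
  assume "u \<in> h1_space"
  then obtain \<phi> where "finitely_supported (\<phi> (0::nat))" "finite_h1_norm (\<lambda>x. u x - \<phi> 0 x)"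
    by (auto simp: h1_space_def)
  then have "(\<lambda>x. ((u x - \<phi> 0 x) + \<phi> 0 x)\<^sup>2) summable_on UNIV"
    by (intro square_summable_add) (auto simp: finite_h1_norm_iff square_summable_finitely_supported)
  then show "(\<lambda>x. (u x)\<^sup>2) summable_on UNIV" by simp
next
  assume u: "(\<lambda>x. (u x)\<^sup>2) summable_on UNIV"
  let ?C = "2 * real (card (nbrs (0 :: int^'n))) + 1" and ?S = "\<Sum>\<^sub>\<infinity>x. (u x)\<^sup>2"
  have "\<exists>A. finite A \<and> ?S - (\<Sum>x\<in>A. (u x)\<^sup>2) < inverse (real (Suc n))" for n
  proof -
    have "eventually (\<lambda>A. dist (\<Sum>x\<in>A. (u x)\<^sup>2) ?S < inverse (real (Suc n))) (finite_subsets_at_top UNIV)"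
      using infsum_tendsto[OF u] by (rule tendstoD) simp
    then show ?thesis
      by (auto simp: eventually_finite_subsets_at_top dist_real_def abs_less_iff)
  qed
  then obtain A where A: "\<And>n. finite (A n)"
    "\<And>n. ?S - (\<Sum>x\<in>A n. (u x)\<^sup>2) < inverse (real (Suc n))" by metis
  define \<phi> where "\<phi> n x = (if x \<in> A n then u x else 0)" for n x
  have fs: "finitely_supported (\<phi> n)" for n
    unfolding finitely_supported_def by (rule finite_subset[OF _ A(1)[of n]]) (auto simp: \<phi>_def)
  have sq: "(u x - \<phi> n x)\<^sup>2 = (u x)\<^sup>2 - (\<phi> n x)\<^sup>2" for n x by (simp add: \<phi>_def)
  have hs: "((\<lambda>x. (u x - \<phi> n x)\<^sup>2) has_sum (?S - (\<Sum>x\<in>A n. (u x)\<^sup>2))) UNIV" for n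
  proof -
    have "((\<lambda>x. (\<phi> n x)\<^sup>2) has_sum (\<Sum>x\<in>A n. (\<phi> n x)\<^sup>2)) UNIV"
      by (rule has_sum_finite_neutralI[where B = "A n"]) (auto simp: A \<phi>_def)
    moreover have "(\<Sum>x\<in>A n. (\<phi> n x)\<^sup>2) = (\<Sum>x\<in>A n. (u x)\<^sup>2)" by (simp add: \<phi>_def)
    ultimately show ?thesis
      unfolding sq using has_sum_add[OF has_sum_infsum[OF u] has_sum_uminusI] by fastforce
  qed
  have "(\<lambda>n. h1_norm (\<lambda>x. u x - \<phi> n x)) \<longlonglongrightarrow> 0"
  proof (rule tendsto_sandwich)
    show "\<forall>\<^sub>F n in sequentially. 0 \<le> h1_norm (\<lambda>x. u x - \<phi> n x)"
      by (simp add: h1_norm_nonneg)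
    have "h1_norm (\<lambda>x. u x - \<phi> n x) \<le> sqrt (?C * inverse (real (Suc n)))" for n
    proof -
      have "h1_norm (\<lambda>x. u x - \<phi> n x) \<le> sqrt (?C * (?S - (\<Sum>x\<in>A n. (u x)\<^sup>2)))"
        using h1_norm_le[OF has_sum_imp_summable[OF hs[of n]]] infsumI[OF hs[of n]] by simp
      also have "\<dots> \<le> sqrt (?C * inverse (real (Suc n)))"
        using A(2)[of n] by (intro real_sqrt_le_mono mult_left_mono) auto
      finally show ?thesis .
    qed
    then show "\<forall>\<^sub>F n in sequentially. h1_norm (\<lambda>x. u x - \<phi> n x) \<le> sqrt (?C * inverse (real (Suc n)))"
      by simp
    show "(\<lambda>n. sqrt (?C * inverse (real (Suc n)))) \<longlonglongrightarrow> 0"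
      using tendsto_real_sqrt[OF tendsto_mult_right_zero[OF LIMSEQ_inverse_real_of_nat, of ?C]] by simp
  qed simp
  then show "u \<in> h1_space"
    unfolding h1_space_def using fs has_sum_imp_summable[OF hs] by (auto simp: finite_h1_norm_iff)
qed

lemma h1_space_add: "u \<in> h1_space \<Longrightarrow> v \<in> h1_space \<Longrightarrow> (\<lambda>x. u x + v x) \<in> h1_space"
  by (simp add: h1_space_iff square_summable_add)

lemma h1_space_scale: "u \<in> h1_space \<Longrightarrow> (\<lambda>x. c * u x) \<in> h1_space"
  by (simp add: h1_space_iff power_mult_distrib summable_on_cmult_right)

typedef ('n::finite) h1 = "h1_space :: (int^'n \<Rightarrow> real) set"
  morphisms h1_fun Abs_h1
  by (rule exI[of _ "\<lambda>_. 0"]) (simp add: h1_space_iff)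

setup_lifting type_definition_h1

lemma h1_fun_square_summable: "(\<lambda>x. (h1_fun u x)\<^sup>2) summable_on UNIV"
  using h1_fun[of u] by (simp add: h1_space_iff)

lemma h1_fun_mult_summable: "(\<lambda>x. h1_fun u x * h1_fun v x) summable_on UNIV"
  by (intro square_summable_prod h1_fun_square_summable)

definition grad_prod :: "(int^'n \<Rightarrow> real) \<Rightarrow> (int^'n \<Rightarrow> real) \<Rightarrow> int^'n \<Rightarrow> real" where
  "grad_prod u v x = (\<Sum>y\<in>nbrs x. (u y - u x) * (v y - v x))"

lemma grad_prod_self: "grad_prod u u = grad_sq u"
  by (simp add: fun_eq_iff grad_prod_def grad_sq_def power2_eq_square)

lemma h1_fun_grad_sq_summable: "grad_sq (h1_fun u) summable_on UNIV"
  by (intro grad_sq_summable h1_fun_square_summable)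

lemma h1_fun_grad_prod_summable: "grad_prod (h1_fun u) (h1_fun v) summable_on UNIV"
proof -
  let ?u = "h1_fun u" and ?v = "h1_fun v"
  have "(\<lambda>x. (?u x + ?v x)\<^sup>2) summable_on UNIV"
    by (intro square_summable_add h1_fun_square_summable)
  then have "(\<lambda>x. 1 / 2 * (grad_sq (\<lambda>x. ?u x + ?v x) x + (-1) * grad_sq ?u x + (-1) * grad_sq ?v x)) summable_on UNIV"
    by (intro summable_on_cmult_right summable_on_add grad_sq_summable(1) h1_fun_square_summable)
  moreover have "1 / 2 * (grad_sq (\<lambda>x. ?u x + ?v x) x - grad_sq ?u x - grad_sq ?v x) = grad_prod ?u ?v x" for x
    unfolding grad_sq_def grad_prod_def sum_subtractf[symmetric] sum_distrib_left
    by (intro sum.cong) (auto simp: power2_eq_square algebra_simps)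
  ultimately show ?thesis by simp
qed

instantiation h1 :: (finite) real_vector
begin

lift_definition zero_h1 :: "'a h1" is "\<lambda>_. 0" by (simp add: h1_space_iff)
lift_definition plus_h1 :: "'a h1 \<Rightarrow> 'a h1 \<Rightarrow> 'a h1" is "\<lambda>u v x. u x + v x" by (rule h1_space_add)
lift_definition scaleR_h1 :: "real \<Rightarrow> 'a h1 \<Rightarrow> 'a h1" is "\<lambda>c u x. c * u x" by (rule h1_space_scale)
lift_definition uminus_h1 :: "'a h1 \<Rightarrow> 'a h1" is "\<lambda>u x. - u x"
  using h1_space_scale[of _ "-1"] by simp
lift_definition minus_h1 :: "'a h1 \<Rightarrow> 'a h1 \<Rightarrow> 'a h1" is "\<lambda>u v x. u x - v x"
  subgoal for u v using h1_space_add[OF _ h1_space_scale, of u v "-1"] by simp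
  done

instance
  by standard (transfer, simp add: algebra_simps)+

end

instantiation h1 :: (finite) real_inner
begin

lift_definition norm_h1 :: "'a h1 \<Rightarrow> real" is h1_norm .

definition inner_h1 :: "'a h1 \<Rightarrow> 'a h1 \<Rightarrow> real" where
  "inner_h1 u v = 1 / 2 * (\<Sum>\<^sub>\<infinity>x. grad_prod (h1_fun u) (h1_fun v) x) + (\<Sum>\<^sub>\<infinity>x. h1_fun u x * h1_fun v x)"
definition sgn_h1 :: "'a h1 \<Rightarrow> 'a h1" where "sgn_h1 u = u /\<^sub>R norm u"
definition dist_h1 :: "'a h1 \<Rightarrow> 'a h1 \<Rightarrow> real" where "dist_h1 u v = norm (u - v)"
definition uniformity_h1 :: "('a h1 \<times> 'a h1) filter" where
  "uniformity_h1 = (INF e\<in>{0<..}. principal {(u, v). dist u v < e})"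
definition open_h1 :: "'a h1 set \<Rightarrow> bool" where
  "open_h1 U \<longleftrightarrow> (\<forall>u\<in>U. eventually (\<lambda>(u', v). u' = u \<longrightarrow> v \<in> U) uniformity)"

instance
proof
  fix u v w :: "'a h1" and a b :: real
  show "sgn u = u /\<^sub>R norm u" by (rule sgn_h1_def)
  show "dist u v = norm (u - v)" by (rule dist_h1_def)
  show "uniformity = (INF e\<in>{0<..}. principal {(u :: 'a h1, v). dist u v < e})"
    by (rule uniformity_h1_def)
  show "open U \<longleftrightarrow> (\<forall>u\<in>U. \<forall>\<^sub>F (u', v) in uniformity. u' = u \<longrightarrow> v \<in> U)" for U :: "'a h1 set"
    by (rule open_h1_def)
  show "inner u v = inner v u"
    by (simp add: inner_h1_def grad_prod_def mult.commute)
  have "grad_prod (h1_fun (u + v)) (h1_fun w) x =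
      grad_prod (h1_fun u) (h1_fun w) x + grad_prod (h1_fun v) (h1_fun w) x" for x
    unfolding grad_prod_def plus_h1.rep_eq sum.distrib[symmetric]
    by (intro sum.cong) (auto simp: algebra_simps)
  then show "inner (u + v) w = inner u w + inner v w"
    by (simp add: inner_h1_def plus_h1.rep_eq distrib_right infsum_add
        h1_fun_grad_prod_summable h1_fun_mult_summable)
  have "grad_prod (h1_fun (a *\<^sub>R u)) (h1_fun v) x = a * grad_prod (h1_fun u) (h1_fun v) x" for x
    unfolding grad_prod_def scaleR_h1.rep_eq sum_distrib_left
    by (intro sum.cong) (auto simp: algebra_simps)
  then show "inner (a *\<^sub>R u) v = a * inner u v"
    by (simp add: inner_h1_def scaleR_h1.rep_eq mult.assoc infsum_cmult_right' distrib_left)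
  have g: "0 \<le> (\<Sum>\<^sub>\<infinity>x. grad_sq (h1_fun u) x)" and s: "0 \<le> (\<Sum>\<^sub>\<infinity>x. (h1_fun u x)\<^sup>2)"
    by (auto intro!: infsum_nonneg grad_sq_nonneg)
  have uu: "inner u u = 1 / 2 * (\<Sum>\<^sub>\<infinity>x. grad_sq (h1_fun u) x) + (\<Sum>\<^sub>\<infinity>x. (h1_fun u x)\<^sup>2)"
    by (simp add: inner_h1_def grad_prod_self power2_eq_square)
  show "0 \<le> inner u u" using g s by (simp add: uu)
  show "norm u = sqrt (inner u u)"
    by (simp add: norm_h1.rep_eq h1_norm_def uu)
  show "inner u u = 0 \<longleftrightarrow> u = 0"
  proof
    assume "inner u u = 0"
    then have "(\<Sum>\<^sub>\<infinity>x. (h1_fun u x)\<^sup>2) \<le> 0" using g s by (simp add: uu)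
    then have "(h1_fun u x)\<^sup>2 = 0" for x
      by (rule nonneg_infsum_le_0D) (auto simp: h1_fun_square_summable)
    then have "h1_fun u = h1_fun 0" by (simp add: fun_eq_iff zero_h1.rep_eq)
    then show "u = 0" by (simp add: h1_fun_inject)
  next
    assume "u = 0"
    then show "inner u u = 0"
      unfolding uu by (simp add: zero_h1.rep_eq grad_sq_def [abs_def])
  qed
qed

end

lemma h1_finitely_supported_dense: "closure {u :: ('n::finite) h1. finitely_supported (h1_fun u)} = UNIV"
proof -
  have "u \<in> closure {u. finitely_supported (h1_fun u)}" for u :: "'n h1"
  proof -
    obtain \<phi> where \<phi>: "\<And>n. finitely_supported (\<phi> n)"
      "(\<lambda>n. h1_norm (\<lambda>x. h1_fun u x - \<phi> n x)) \<longlonglongrightarrow> 0"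
      using h1_fun[of u] by (auto simp: h1_space_def)
    have r: "h1_fun (Abs_h1 (\<phi> n)) = \<phi> n" for n
      by (rule Abs_h1_inverse) (simp add: h1_space_iff square_summable_finitely_supported \<phi>)
    have "(\<lambda>n. dist (Abs_h1 (\<phi> n)) u) \<longlonglongrightarrow> 0"
      using \<phi>(2) by (subst dist_commute) (simp add: dist_norm norm_h1.rep_eq minus_h1.rep_eq r)
    then have "(\<lambda>n. Abs_h1 (\<phi> n)) \<longlonglongrightarrow> u" by (rule iffD2[OF tendsto_dist_iff])
    then show ?thesis
      unfolding closure_sequential by (intro exI[of _ "\<lambda>n. Abs_h1 (\<phi> n)"]) (simp add: r \<phi>)
  qed
  then show ?thesis by auto
qed

lemma h1_norm_sq:
  "(norm u)\<^sup>2 = (\<Sum>\<^sub>\<infinity>x. 1 / 2 * grad_sq (h1_fun u) x + (h1_fun u x)\<^sup>2)"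
  "(\<lambda>x. 1 / 2 * grad_sq (h1_fun u) x + (h1_fun u x)\<^sup>2) summable_on UNIV"
proof -
  show "(\<lambda>x. 1 / 2 * grad_sq (h1_fun u) x + (h1_fun u x)\<^sup>2) summable_on UNIV"
    by (intro summable_on_add summable_on_cmult_right h1_fun_grad_sq_summable h1_fun_square_summable)
  have "0 \<le> (\<Sum>\<^sub>\<infinity>x. grad_sq (h1_fun u) x)" "0 \<le> (\<Sum>\<^sub>\<infinity>x. (h1_fun u x)\<^sup>2)"
    by (auto intro!: infsum_nonneg grad_sq_nonneg)
  then show "(norm u)\<^sup>2 = (\<Sum>\<^sub>\<infinity>x. 1 / 2 * grad_sq (h1_fun u) x + (h1_fun u x)\<^sup>2)"
    unfolding infsum_add[OF summable_on_cmult_right[OF h1_fun_grad_sq_summable] h1_fun_square_summable]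
      infsum_cmult_right'
    by (simp add: norm_h1.rep_eq h1_norm_def)
qed

lemma h1_sum_le_norm_sq:
  assumes "finite A"
  shows "(\<Sum>x\<in>A. 1 / 2 * grad_sq (h1_fun u) x + (h1_fun u x)\<^sup>2) \<le> (norm u)\<^sup>2"
  unfolding h1_norm_sq(1)
  by (rule finite_sum_le_infsum[OF h1_norm_sq(2) assms]) (auto simp: grad_sq_nonneg)

lemma h1_fun_le_norm: "\<bar>h1_fun u x\<bar> \<le> norm u"
proof -
  have "(h1_fun u x)\<^sup>2 \<le> (norm u)\<^sup>2"
    using h1_sum_le_norm_sq[of "{x}" u] grad_sq_nonneg[of "h1_fun u" x] by simp
  then show ?thesis by (simp add: abs_le_square_iff[symmetric])
qed

instance h1 :: (finite) complete_space
proof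
  fix X :: "nat \<Rightarrow> 'a h1" assume X: "Cauchy X"
  have "Cauchy (\<lambda>n. h1_fun (X n) x)" for x
  proof (rule metric_CauchyI)
    fix e :: real assume "0 < e"
    then obtain M where M: "\<forall>m\<ge>M. \<forall>n\<ge>M. dist (X m) (X n) < e" using metric_CauchyD[OF X] by blast
    have "dist (h1_fun (X m) x) (h1_fun (X n) x) \<le> dist (X m) (X n)" for m n
      using h1_fun_le_norm[of "X m - X n" x] by (simp add: dist_norm minus_h1.rep_eq)
    then show "\<exists>M. \<forall>m\<ge>M. \<forall>n\<ge>M. dist (h1_fun (X m) x) (h1_fun (X n) x) < e"
      using M by (meson le_less_trans)
  qed
  then have "\<exists>l. (\<lambda>n. h1_fun (X n) x) \<longlonglongrightarrow> l" for x
    by (simp add: Cauchy_convergent_iff convergent_def)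
  then obtain l where l: "\<And>x. (\<lambda>n. h1_fun (X n) x) \<longlonglongrightarrow> l x" by metis
  let ?e = "\<lambda>u x. 1 / 2 * grad_sq u x + (u x)\<^sup>2"
  have bound: "(\<Sum>x\<in>A. ?e (\<lambda>x. l x - h1_fun (X n) x) x) \<le> e\<^sup>2"
    if "finite A" "\<forall>m\<ge>M. dist (X m) (X n) < e" for A n M e
  proof (rule LIMSEQ_le_const2)
    show "(\<lambda>m. \<Sum>x\<in>A. ?e (\<lambda>x. h1_fun (X m) x - h1_fun (X n) x) x)
        \<longlonglongrightarrow> (\<Sum>x\<in>A. ?e (\<lambda>x. l x - h1_fun (X n) x) x)"
      unfolding grad_sq_def by (intro tendsto_intros l)
    have "(\<Sum>x\<in>A. ?e (\<lambda>x. h1_fun (X m) x - h1_fun (X n) x) x) \<le> e\<^sup>2" if "m \<ge> M" for m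
    proof -
      have "(\<Sum>x\<in>A. ?e (\<lambda>x. h1_fun (X m) x - h1_fun (X n) x) x) \<le> (dist (X m) (X n))\<^sup>2"
        using h1_sum_le_norm_sq[OF \<open>finite A\<close>, of "X m - X n"] by (simp add: dist_norm minus_h1.rep_eq)
      also have "\<dots> \<le> e\<^sup>2"
        using \<open>\<forall>m\<ge>M. dist (X m) (X n) < e\<close> that by (intro power_mono) (auto intro: less_imp_le)
      finally show ?thesis .
    qed
    then show "\<exists>N. \<forall>m\<ge>N. (\<Sum>x\<in>A. ?e (\<lambda>x. h1_fun (X m) x - h1_fun (X n) x) x) \<le> e\<^sup>2" by blast
  qed
  have sq: "(\<lambda>x. (l x - h1_fun (X n) x)\<^sup>2) summable_on UNIV"
    if "\<forall>m\<ge>M. dist (X m) (X n) < e" for n M e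
  proof (rule nonneg_bounded_partial_sums_imp_summable_on)
    show "\<forall>\<^sub>F A in finite_subsets_at_top UNIV. (\<Sum>x\<in>A. (l x - h1_fun (X n) x)\<^sup>2) \<le> e\<^sup>2"
    proof (rule eventually_finite_subsets_at_top_weakI)
      fix A :: "(int^'a) set" assume "finite A"
      have "(\<Sum>x\<in>A. (l x - h1_fun (X n) x)\<^sup>2) \<le> (\<Sum>x\<in>A. ?e (\<lambda>x. l x - h1_fun (X n) x) x)"
        by (intro sum_mono) (simp add: grad_sq_nonneg)
      then show "(\<Sum>x\<in>A. (l x - h1_fun (X n) x)\<^sup>2) \<le> e\<^sup>2"
        using bound[OF \<open>finite A\<close> that] by linarith
    qed
  qed auto
  obtain M0 where M0: "\<forall>m\<ge>M0. dist (X m) (X M0) < 1"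
    using metric_CauchyD[OF X, of 1] by auto
  have "(\<lambda>x. ((l x - h1_fun (X M0) x) + h1_fun (X M0) x)\<^sup>2) summable_on UNIV"
    by (intro square_summable_add h1_fun_square_summable sq[OF M0])
  then have L: "h1_fun (Abs_h1 l) = l"
    by (intro Abs_h1_inverse) (simp add: h1_space_iff)
  have "X \<longlonglongrightarrow> Abs_h1 l"
  proof (rule metric_LIMSEQ_I)
    fix e :: real assume "0 < e"
    then obtain M where M: "\<forall>m\<ge>M. \<forall>n\<ge>M. dist (X m) (X n) < e / 2"
      using metric_CauchyD[OF X, of "e / 2"] by auto
    have "dist (X n) (Abs_h1 l) < e" if "n \<ge> M" for n
    proof -
      have "(norm (Abs_h1 l - X n))\<^sup>2 \<le> (e / 2)\<^sup>2"
        unfolding h1_norm_sq(1)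
      proof (rule infsum_le_finite_sums[OF h1_norm_sq(2)])
        fix A :: "(int^'a) set" assume "finite A"
        then show "(\<Sum>x\<in>A. ?e (h1_fun (Abs_h1 l - X n)) x) \<le> (e / 2)\<^sup>2"
          using bound[of A M n "e / 2"] M that by (simp add: minus_h1.rep_eq L)
      qed
      then have "norm (Abs_h1 l - X n) \<le> e / 2"
        by (rule power2_le_imp_le) (use \<open>0 < e\<close> in simp)
      then show ?thesis using \<open>0 < e\<close> by (simp add: dist_norm norm_minus_commute)
    qed
    then show "\<exists>M. \<forall>n\<ge>M. dist (X n) (Abs_h1 l) < e" by blast
  qed
  then show "convergent X" by (auto simp: convergent_def)
qed

instance h1 :: (finite) banach ..


section \<open>The equation and its energy functional\<close>

text \<open>The interval integral is oriented: for \<open>u < 0\<close> it is minus the integral over \<open>[u, 0]\<close>.\<close>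

definition primitive :: "('v \<Rightarrow> real \<Rightarrow> real) \<Rightarrow> 'v \<Rightarrow> real \<Rightarrow> real" where
  "primitive f x u = (LBINT s=0..u. f x s)"

definition energy :: "(int^'n \<Rightarrow> real) \<Rightarrow> (int^'n \<Rightarrow> real \<Rightarrow> real) \<Rightarrow> 'n h1 \<Rightarrow> real" where
  "energy V f u =
     1 / 2 * (\<Sum>\<^sub>\<infinity>x. 1 / 2 * (\<Sum>y\<in>nbrs x. (h1_fun u y - h1_fun u x)\<^sup>2) + V x * (h1_fun u x)\<^sup>2)
     - (\<Sum>\<^sub>\<infinity>x. primitive f x (h1_fun u x))"

definition solves :: "(int^'n \<Rightarrow> real) \<Rightarrow> (int^'n \<Rightarrow> real \<Rightarrow> real) \<Rightarrow> 'n h1 \<Rightarrow> bool" where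
  "solves V f u \<longleftrightarrow> (\<forall>x. - laplacian (h1_fun u) x + V x * h1_fun u x = f x (h1_fun u x))"

definition critical_point :: "('a::real_normed_vector \<Rightarrow> real) \<Rightarrow> 'a \<Rightarrow> bool" where
  "critical_point \<Phi> u \<longleftrightarrow> (\<Phi> has_derivative (\<lambda>_. 0)) (at u)"

definition ground_state :: "(int^'n \<Rightarrow> real) \<Rightarrow> (int^'n \<Rightarrow> real \<Rightarrow> real) \<Rightarrow> 'n h1 \<Rightarrow> bool" where
  "ground_state V f u \<longleftrightarrow>
     solves V f u \<and> critical_point (energy V f) u \<and> energy V f u > 0 \<and>
     (\<forall>v. critical_point (energy V f) v \<and> energy V f v > 0 \<longrightarrow> energy V f u \<le> energy V f v)"

end

theory Submission
  imports Defs "HOL-Complex_Analysis.Great_Picard"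
begin

text \<open>
  The energy is \<open>E u = quad u / 2 - potential u\<close>, where \<open>quad\<close> is the square of a norm equivalent to that
  of \<open>H\<^sup>1\<close>.  Every nonzero critical point lies on the Nehari set of those \<open>u \<noteq> 0\<close> at which the
  derivative of \<open>E\<close> along the ray through \<open>u\<close> vanishes.  It therefore suffices to find a minimiser of
  \<open>E\<close> on that set and to show that it is a critical point.

  On each ray \<open>t \<mapsto> t *\<^sub>R u\<close> the picture is one dimensional.  The monotonicity of \<open>f x u / \<bar>u\<bar>\<close> says that
  \<open>F x (t * u)\<close> is a strictly convex function of \<open>t\<^sup>2\<close> (\<open>F_above_tangent\<close>).  Hence a Nehari point is
  the strict maximum of \<open>E\<close> on its ray (\<open>nehari_strict_max\<close>), and \<open>E (t *\<^sub>R u) / t\<^sup>2\<close> decreases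
  (\<open>energy_scaling\<close>).  Since \<open>E\<close> is positive near \<open>0\<close> and \<open>F\<close> is superquadratic, every ray meets the
  Nehari set (\<open>nehari_ray\<close>), and the ground level, the infimum \<open>c\<close> of \<open>E\<close> on the Nehari set, is
  positive.

  A minimiser is found by concentration compactness on the directions alone.  Let \<open>v n\<close> be the unit
  vectors on the rays of a minimising sequence.  All multiples \<open>t *\<^sub>R v n\<close> have energy at most
  \<open>c + 1 / (n + 1)\<close>, which prevents \<open>v n\<close> from tending to \<open>0\<close> uniformly (\<open>nonvanishing\<close>).  Translation
  by periods leaves \<open>E\<close> unchanged, so one may assume that \<open>v n\<close> tends pointwise to some \<open>w \<noteq> 0\<close>
  (\<open>minimising_profile\<close>).  The energy then splits,
  \<open>E (t *\<^sub>R v n) = E (t *\<^sub>R w) + E (t *\<^sub>R (v n - w)) + o(1)\<close> uniformly for bounded \<open>t\<close>, because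
  \<open>F x (p + r) - F x p - F x r\<close> is at most a constant times \<open>\<bar>p * r\<bar>\<close> (\<open>F_interaction\<close>,
  \<open>energy_splitting\<close>).  The two parts cannot both carry energy \<open>c\<close>; comparing the parameters at which
  the rays of \<open>w\<close> and of \<open>v n - w\<close> meet the Nehari set shows that the multiple of \<open>w\<close> on the Nehari
  set has energy exactly \<open>c\<close> (\<open>ground_level_attained\<close>).

  Finally, if the equation failed for a minimiser at some vertex, a small change at this vertex would
  push the maximum of \<open>E\<close> over the ray below \<open>c\<close> (\<open>nehari_minimiser_solves\<close>).
\<close>

section \<open>Square summable families\<close>

lemma has_sum_minus_real:
  fixes g h :: "'a \<Rightarrow> real"
  assumes "(g has_sum S) A" "(h has_sum S') A"
  shows "((\<lambda>x. g x - h x) has_sum (S - S')) A"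
  using has_sum_add[OF assms(1) has_sum_uminusI[OF assms(2)]] by simp

lemma summable_on_real_bound:
  fixes g h :: "'a \<Rightarrow> real"
  assumes "h summable_on A" "\<And>x. x \<in> A \<Longrightarrow> \<bar>g x\<bar> \<le> h x"
  shows "g summable_on A" and "(\<lambda>x. \<bar>g x\<bar>) summable_on A" and "\<bar>infsum g A\<bar> \<le> infsum h A"
proof -
  show *: "(\<lambda>x. \<bar>g x\<bar>) summable_on A"
    by (rule summable_on_comparison_test[OF assms(1)]) (use assms(2) in auto)
  then show "g summable_on A"
    using abs_summable_summable[of g A] by simp
  have "\<bar>infsum g A\<bar> \<le> infsum (\<lambda>x. \<bar>g x\<bar>) A"
    using norm_infsum_bound[of g A] * by simp
  also have "\<dots> \<le> infsum h A"
    by (rule infsum_mono[OF * assms(1)]) (use assms(2) in auto)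
  finally show "\<bar>infsum g A\<bar> \<le> infsum h A" .
qed

lemma summable_tail_small:
  fixes g :: "'a \<Rightarrow> real"
  assumes g: "g summable_on UNIV" and "0 < e"
  obtains A where "finite A" "infsum g (- A) < e"
proof -
  have "eventually (\<lambda>A. dist (sum g A) (infsum g UNIV) < e) (finite_subsets_at_top UNIV)"
    using infsum_tendsto[OF g] \<open>0 < e\<close> by (rule tendstoD)
  then obtain A where A: "finite A" "dist (sum g A) (infsum g UNIV) < e"
    by (auto simp: eventually_finite_subsets_at_top)
  have "infsum g (A \<union> - A) = infsum g A + infsum g (- A)"
    using A(1) summable_on_cofin_subset[OF g A(1)]
    by (intro infsum_Un_disjoint) (auto simp: Compl_eq_Diff_UNIV)
  then have "infsum g (- A) < e" using A by (simp add: dist_real_def)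
  with A(1) show ?thesis by (rule that)
qed

lemma infsum_split_finite:
  fixes g :: "'a \<Rightarrow> real"
  assumes g: "g summable_on UNIV" and A: "finite A"
  shows "infsum g UNIV = sum g A + infsum g (- A)" and "g summable_on (- A)"
proof -
  show *: "g summable_on (- A)"
    using summable_on_cofin_subset[OF g A] by (simp add: Compl_eq_Diff_UNIV)
  show "infsum g UNIV = sum g A + infsum g (- A)"
    using infsum_Un_disjoint[of g A "- A"] A * by auto
qed

lemma square_summable_finite_ge:
  fixes u :: "'a \<Rightarrow> real"
  assumes u: "(\<lambda>x. (u x)\<^sup>2) summable_on UNIV" and "0 < d"
  shows "finite {x. d \<le> \<bar>u x\<bar>}"
proof -
  obtain A where A: "finite A" "infsum (\<lambda>x. (u x)\<^sup>2) (- A) < d\<^sup>2"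
    using summable_tail_small[OF u, of "d\<^sup>2"] \<open>0 < d\<close> by auto
  have "\<bar>u x\<bar> < d" if "x \<notin> A" for x
  proof -
    have "(\<Sum>x\<in>{x}. (u x)\<^sup>2) \<le> infsum (\<lambda>x. (u x)\<^sup>2) (- A)"
      using that infsum_split_finite(2)[OF u A(1)] by (intro finite_sum_le_infsum) auto
    then have "\<bar>u x\<bar>\<^sup>2 < d\<^sup>2" using A(2) by simp
    then show ?thesis using \<open>0 < d\<close> by (simp add: power2_less_imp_less)
  qed
  then have "{x. d \<le> \<bar>u x\<bar>} \<subseteq> A" by (auto simp: not_le[symmetric])
  then show ?thesis using A(1) by (rule finite_subset)
qed

text \<open>
  A bounded sequence that tends to \<open>0\<close> pointwise tends to \<open>0\<close> weakly, even with absolute values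
  inside: the tail of \<open>g\<close> is small, and on a finite set pointwise convergence suffices.
\<close>

lemma infsum_abs_pairing_tendsto_0:
  fixes g :: "'a \<Rightarrow> real" and w :: "nat \<Rightarrow> 'a \<Rightarrow> real"
  assumes g: "(\<lambda>x. (g x)\<^sup>2) summable_on UNIV"
    and w: "\<And>n. (\<lambda>x. (w n x)\<^sup>2) summable_on UNIV" "\<And>n. (\<Sum>\<^sub>\<infinity>x. (w n x)\<^sup>2) \<le> K"
    and lim: "\<And>x. (\<lambda>n. w n x) \<longlonglongrightarrow> 0"
  shows "(\<lambda>n. \<Sum>\<^sub>\<infinity>x. \<bar>g x * w n x\<bar>) \<longlonglongrightarrow> 0"
proof (rule LIMSEQ_I)
  fix e :: real assume e: "0 < e"
  have K: "0 \<le> K" using w(2)[of 0] infsum_nonneg[of UNIV "\<lambda>x. (w 0 x)\<^sup>2"] by simp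
  \<comment> \<open>The weight in Young's inequality \<open>2 \<bar>g\<bar> \<bar>w\<bar> \<le> L g\<^sup>2 + w\<^sup>2 / L\<close>, so large that \<open>K / L\<close> is below \<open>e / 3\<close>.\<close>
  define L where "L = 3 * (K + 1) / e"
  have L: "0 < L" using K e by (simp add: L_def)
  obtain A where A: "finite A" "(\<Sum>\<^sub>\<infinity>x\<in>-A. (g x)\<^sup>2) < e / (3 * L)"
    using summable_tail_small[OF g, of "e / (3 * L)"] e L by auto
  have "(\<lambda>n. \<Sum>x\<in>A. \<bar>g x * w n x\<bar>) \<longlonglongrightarrow> (\<Sum>x\<in>A. \<bar>g x * 0\<bar>)"
    by (intro tendsto_intros lim)
  then have "eventually (\<lambda>n. (\<Sum>x\<in>A. \<bar>g x * w n x\<bar>) < e / 3) sequentially"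
    by (rule order_tendstoD) (use e in simp)
  then obtain N where N: "\<And>n. n \<ge> N \<Longrightarrow> (\<Sum>x\<in>A. \<bar>g x * w n x\<bar>) < e / 3"
    by (auto simp: eventually_sequentially)
  have "norm ((\<Sum>\<^sub>\<infinity>x. \<bar>g x * w n x\<bar>) - 0) < e" if "n \<ge> N" for n
  proof -
    have s: "(\<lambda>x. \<bar>g x * w n x\<bar>) summable_on UNIV"
    proof (rule summable_on_real_bound(2))
      show "(\<lambda>x. (g x)\<^sup>2 + (w n x)\<^sup>2) summable_on UNIV" by (intro summable_on_add g w)
      show "\<bar>g x * w n x\<bar> \<le> (g x)\<^sup>2 + (w n x)\<^sup>2" for x
        using zero_le_power2[of "\<bar>g x\<bar> - \<bar>w n x\<bar>"] abs_ge_zero[of "g x * w n x"]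
        unfolding power2_diff abs_mult power2_abs by linarith
    qed
    have gA: "(\<lambda>x. (g x)\<^sup>2) summable_on (- A)" and wA: "(\<lambda>x. (w n x)\<^sup>2) summable_on (- A)"
      by (intro infsum_split_finite(2) g w A)+
    have "(\<Sum>\<^sub>\<infinity>x\<in>-A. \<bar>g x * w n x\<bar>) \<le> (\<Sum>\<^sub>\<infinity>x\<in>-A. L * (g x)\<^sup>2 + (1 / L) * (w n x)\<^sup>2)"
    proof (intro infsum_mono summable_on_add summable_on_cmult_right gA wA infsum_split_finite(2) s A)
      fix x
      have "2 * (\<bar>g x\<bar> * \<bar>w n x\<bar>) \<le> L * (g x)\<^sup>2 + (1 / L) * (w n x)\<^sup>2"
        using zero_le_power2[of "L * \<bar>g x\<bar> - \<bar>w n x\<bar>"] L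
        by (simp add: power2_diff power_mult_distrib field_simps power2_eq_square)
      then show "\<bar>g x * w n x\<bar> \<le> L * (g x)\<^sup>2 + (1 / L) * (w n x)\<^sup>2"
        using abs_ge_zero[of "g x * w n x"] unfolding abs_mult by linarith
    qed
    also have "\<dots> = L * (\<Sum>\<^sub>\<infinity>x\<in>-A. (g x)\<^sup>2) + (1 / L) * (\<Sum>\<^sub>\<infinity>x\<in>-A. (w n x)\<^sup>2)"
      by (simp only: infsum_add[OF summable_on_cmult_right[OF gA] summable_on_cmult_right[OF wA]]
          infsum_cmult_right')
    also have "\<dots> \<le> L * (e / (3 * L)) + (1 / L) * K"
    proof (intro add_mono mult_left_mono)
      have "(\<Sum>\<^sub>\<infinity>x\<in>-A. (w n x)\<^sup>2) \<le> (\<Sum>\<^sub>\<infinity>x. (w n x)\<^sup>2)"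
        using infsum_split_finite(1)[OF w(1)[of n] A(1)] sum_nonneg[of A "\<lambda>x. (w n x)\<^sup>2"] by simp
      then show "(\<Sum>\<^sub>\<infinity>x\<in>-A. (w n x)\<^sup>2) \<le> K" using w(2)[of n] by linarith
    qed (use A L in auto)
    also have "\<dots> < e / 3 + e / 3"
    proof -
      have "(1 / L) * K < e / 3" using K e by (simp add: L_def field_simps)
      then show ?thesis using L by simp
    qed
    finally have "(\<Sum>\<^sub>\<infinity>x\<in>-A. \<bar>g x * w n x\<bar>) < e / 3 + e / 3" .
    then have "(\<Sum>\<^sub>\<infinity>x. \<bar>g x * w n x\<bar>) < e"
      using infsum_split_finite(1)[OF s A(1)] N[OF that] by linarith
    moreover have "0 \<le> (\<Sum>\<^sub>\<infinity>x. \<bar>g x * w n x\<bar>)" by (rule infsum_nonneg) simp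
    ultimately show ?thesis by simp
  qed
  then show "\<exists>N. \<forall>n\<ge>N. norm ((\<Sum>\<^sub>\<infinity>x. \<bar>g x * w n x\<bar>) - 0) < e" by blast
qed

section \<open>The space \<open>H\<^sup>1\<close>\<close>

lemma h1_fun_Abs: "(\<lambda>x. (g x)\<^sup>2) summable_on UNIV \<Longrightarrow> h1_fun (Abs_h1 g) = g"
  by (rule Abs_h1_inverse) (simp add: h1_space_iff)

lemma h1_nonzero_coordinate:
  assumes "u \<noteq> 0"
  obtains x where "h1_fun u x \<noteq> 0"
  using assms by (metis h1_fun_inject zero_h1.rep_eq ext)

definition unit_at :: "int^'n \<Rightarrow> ('n::finite) h1" where
  "unit_at x = Abs_h1 (\<lambda>y. if y = x then 1 else 0)"

lemma h1_fun_unit_at: "h1_fun (unit_at x) y = (if y = x then 1 else 0)"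
  unfolding unit_at_def by (subst h1_fun_Abs) (auto intro!: square_summable_finitely_supported simp: finitely_supported_def)

lemma pairing_unit_at: "(\<Sum>\<^sub>\<infinity>y. g y * h1_fun (unit_at x) y) = g x"
proof -
  have "((\<lambda>y. g y * h1_fun (unit_at x) y) has_sum (\<Sum>y\<in>{x}. g y * h1_fun (unit_at x) y)) UNIV"
    by (rule has_sum_finite_neutralI[where B = "{x}"]) (auto simp: h1_fun_unit_at)
  from infsumI[OF this] show ?thesis by (simp add: h1_fun_unit_at)
qed

lemma h1_sum_square_le: "(\<Sum>\<^sub>\<infinity>x. (h1_fun u x)\<^sup>2) \<le> (norm u)\<^sup>2"
  unfolding h1_norm_sq(1)
  by (rule infsum_mono[OF h1_fun_square_summable h1_norm_sq(2)]) (simp add: grad_sq_nonneg)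

lemma h1_Cauchy_Schwarz: "(\<Sum>\<^sub>\<infinity>x. \<bar>h1_fun u x * h1_fun v x\<bar>) \<le> norm u * norm v"
  and h1_abs_mult_summable: "(\<lambda>x. \<bar>h1_fun u x * h1_fun v x\<bar>) summable_on UNIV"
proof -
  show s: "(\<lambda>x. \<bar>h1_fun u x * h1_fun v x\<bar>) summable_on UNIV"
    using square_summable_prod[of "\<lambda>x. \<bar>h1_fun u x\<bar>" UNIV "\<lambda>x. \<bar>h1_fun v x\<bar>"]
    by (simp add: h1_fun_square_summable abs_mult)
  have le: "L2_set (h1_fun u) A \<le> norm u" if "finite A" for A and u :: "'a h1"
  proof -
    have "(\<Sum>x\<in>A. (h1_fun u x)\<^sup>2) \<le> (\<Sum>\<^sub>\<infinity>x. (h1_fun u x)\<^sup>2)"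
      by (rule finite_sum_le_infsum[OF h1_fun_square_summable that]) auto
    then have "(\<Sum>x\<in>A. (h1_fun u x)\<^sup>2) \<le> (norm u)\<^sup>2" using h1_sum_square_le[of u] by linarith
    then show ?thesis unfolding L2_set_def by (simp add: real_le_lsqrt sum_nonneg)
  qed
  show "(\<Sum>\<^sub>\<infinity>x. \<bar>h1_fun u x * h1_fun v x\<bar>) \<le> norm u * norm v"
  proof (rule infsum_le_finite_sums[OF s])
    fix A :: "(int^'a) set" assume A: "finite A"
    have "(\<Sum>x\<in>A. \<bar>h1_fun u x * h1_fun v x\<bar>) \<le> L2_set (h1_fun u) A * L2_set (h1_fun v) A"
      using L2_set_mult_ineq[of "h1_fun u" "h1_fun v" A] by (simp add: abs_mult)
    also have "\<dots> \<le> norm u * norm v" by (intro mult_mono le A) auto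
    finally show "(\<Sum>x\<in>A. \<bar>h1_fun u x * h1_fun v x\<bar>) \<le> norm u * norm v" .
  qed
qed

text \<open>
  The bound is Cauchy--Schwarz: a square summable \<open>g\<close> is itself an element of \<open>H\<^sup>1\<close>.
\<close>

lemma bounded_linear_pairing:
  fixes g :: "int^('n::finite) \<Rightarrow> real"
  assumes "(\<lambda>x. (g x)\<^sup>2) summable_on UNIV"
  shows "bounded_linear (\<lambda>h. \<Sum>\<^sub>\<infinity>x. g x * h1_fun h x)"
proof -
  have g: "h1_fun (Abs_h1 g) = g" using assms by (rule h1_fun_Abs)
  have s: "(\<lambda>x. g x * h1_fun h x) summable_on UNIV" for h
    by (intro square_summable_prod assms h1_fun_square_summable)
  show ?thesis
  proof (rule bounded_linear_intro[where K = "norm (Abs_h1 g)"])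
    show "(\<Sum>\<^sub>\<infinity>x. g x * h1_fun (h + k) x) = (\<Sum>\<^sub>\<infinity>x. g x * h1_fun h x) + (\<Sum>\<^sub>\<infinity>x. g x * h1_fun k x)" for h k
      by (simp add: plus_h1.rep_eq distrib_left infsum_add s)
    show "(\<Sum>\<^sub>\<infinity>x. g x * h1_fun (r *\<^sub>R h) x) = r *\<^sub>R (\<Sum>\<^sub>\<infinity>x. g x * h1_fun h x)" for r h
      by (simp add: scaleR_h1.rep_eq mult.left_commute infsum_cmult_right')
    show "norm (\<Sum>\<^sub>\<infinity>x. g x * h1_fun h x) \<le> norm h * norm (Abs_h1 g)" for h
    proof -
      have "\<bar>\<Sum>\<^sub>\<infinity>x. g x * h1_fun h x\<bar> \<le> (\<Sum>\<^sub>\<infinity>x. \<bar>g x * h1_fun h x\<bar>)"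
        using h1_abs_mult_summable[of "Abs_h1 g" h] unfolding g by (rule summable_on_real_bound(3)) simp
      then show ?thesis using h1_Cauchy_Schwarz[of "Abs_h1 g" h] unfolding g by (simp add: mult.commute)
    qed
  qed
qed

lemma h1_fun_tendsto:
  assumes "(g \<longlongrightarrow> u) G"
  shows "((\<lambda>n. h1_fun (g n) x) \<longlongrightarrow> h1_fun u x) G"
  using assms
proof (rule metric_tendsto_imp_tendsto)
  show "\<forall>\<^sub>F n in G. dist (h1_fun (g n) x) (h1_fun u x) \<le> dist (g n) u"
    using h1_fun_le_norm[of "g _ - u" x] by (simp add: dist_norm minus_h1.rep_eq)
qed

text \<open>
  Balls of \<open>H\<^sup>1\<close> are sequentially compact for pointwise convergence: the lattice is countable, so a
  diagonal argument applies, and the norm bound passes to the limit on finite sets.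
\<close>

lemma bounded_pointwise_subsequence:
  fixes v :: "nat \<Rightarrow> ('n::finite) h1"
  assumes v: "\<And>n. norm (v n) \<le> K"
  obtains k w where "strict_mono k" "\<And>x. (\<lambda>n. h1_fun (v (k n)) x) \<longlonglongrightarrow> h1_fun w x"
proof -
  have nb: "norm (h1_fun (v n) x) \<le> K" for n x
    using h1_fun_le_norm[of "v n" x] v[of n] by simp
  obtain k :: "nat \<Rightarrow> nat" where k: "strict_mono k"
    "\<And>x. \<exists>l. (\<lambda>n. h1_fun (v (k n)) x) \<longlonglongrightarrow> l"
  proof (rule function_convergent_subsequence[of "UNIV :: (int^'n) set" "\<lambda>n. h1_fun (v n)" K])
    fix k :: "nat \<Rightarrow> nat"
    assume "strict_mono k" "\<And>x. x \<in> UNIV \<Longrightarrow> \<exists>l. (\<lambda>n. h1_fun (v (k n)) x) \<longlonglongrightarrow> l"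
    then show thesis by (intro that[of k]) auto
  qed (auto intro: nb[unfolded real_norm_def])
  from k(2) obtain l where l: "\<And>x. (\<lambda>n. h1_fun (v (k n)) x) \<longlonglongrightarrow> l x" by metis
  have "(\<lambda>x. (l x)\<^sup>2) summable_on UNIV"
  proof (rule nonneg_bounded_partial_sums_imp_summable_on)
    show "\<forall>\<^sub>F A in finite_subsets_at_top UNIV. (\<Sum>x\<in>A. (l x)\<^sup>2) \<le> K\<^sup>2"
    proof (rule eventually_finite_subsets_at_top_weakI)
      fix A :: "(int^'n) set" assume A: "finite A"
      have "(\<Sum>x\<in>A. (h1_fun (v (k n)) x)\<^sup>2) \<le> K\<^sup>2" for n
      proof -
        have "(\<Sum>x\<in>A. (h1_fun (v (k n)) x)\<^sup>2) \<le> (\<Sum>\<^sub>\<infinity>x. (h1_fun (v (k n)) x)\<^sup>2)"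
          by (rule finite_sum_le_infsum[OF h1_fun_square_summable A]) auto
        also have "\<dots> \<le> (norm (v (k n)))\<^sup>2" by (rule h1_sum_square_le)
        also have "\<dots> \<le> K\<^sup>2" by (intro power_mono v) simp
        finally show ?thesis .
      qed
      moreover have "(\<lambda>n. \<Sum>x\<in>A. (h1_fun (v (k n)) x)\<^sup>2) \<longlonglongrightarrow> (\<Sum>x\<in>A. (l x)\<^sup>2)"
        by (intro tendsto_intros l)
      ultimately show "(\<Sum>x\<in>A. (l x)\<^sup>2) \<le> K\<^sup>2" by (intro LIMSEQ_le_const2) auto
    qed
  qed simp
  then show ?thesis using k(1) l by (intro that[of k "Abs_h1 l"]) (simp_all add: h1_fun_Abs)
qed

lemma has_sum_translate_iff:
  fixes g :: "int^'n \<Rightarrow> real"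
  shows "((\<lambda>x. g (x + z)) has_sum S) UNIV \<longleftrightarrow> (g has_sum S) UNIV"
  using has_sum_reindex_bij_betw[of "\<lambda>x. x + z" UNIV UNIV g S] by (simp add: bij_plus_right)

lemma infsum_translate: "(\<Sum>\<^sub>\<infinity>x. g (x + z)) = infsum g UNIV" for g :: "int^'n \<Rightarrow> real"
  using infsum_reindex_bij_betw[of "\<lambda>x. x + z" UNIV UNIV g] by (simp add: bij_plus_right)

lemma summable_on_translate_iff:
  "(\<lambda>x. g (x + z)) summable_on UNIV \<longleftrightarrow> g summable_on UNIV" for g :: "int^'n \<Rightarrow> real"
  by (simp add: summable_on_def has_sum_translate_iff)

definition shift :: "int^'n \<Rightarrow> ('n::finite) h1 \<Rightarrow> 'n h1" where
  "shift z u = Abs_h1 (\<lambda>x. h1_fun u (x + z))"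

lemma h1_fun_shift: "h1_fun (shift z u) x = h1_fun u (x + z)"
  unfolding shift_def
  by (subst h1_fun_Abs) (simp_all add: summable_on_translate_iff[of "\<lambda>x. (h1_fun u x)\<^sup>2"] h1_fun_square_summable)

lemma shift_scaleR: "shift z (t *\<^sub>R u) = t *\<^sub>R shift z u"
  by (simp add: h1_fun_inject[symmetric] fun_eq_iff h1_fun_shift scaleR_h1.rep_eq)

lemma grad_sq_shift: "grad_sq (h1_fun (shift z u)) x = grad_sq (h1_fun u) (x + z)"
  unfolding grad_sq_def sum_nbrs[of _ x] sum_nbrs[of _ "x + z"]
  by (simp add: h1_fun_shift add_ac)

lemma norm_shift: "norm (shift z u) = norm u"
proof -
  have "(norm (shift z u))\<^sup>2 = (norm u)\<^sup>2"
    unfolding h1_norm_sq(1) grad_sq_shift h1_fun_shift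
    by (rule infsum_translate[of "\<lambda>x. 1 / 2 * grad_sq (h1_fun u) x + (h1_fun u x)\<^sup>2"])
  then show ?thesis by simp
qed

lemma laplacian_square_summable: "(\<lambda>x. (laplacian (h1_fun u) x)\<^sup>2) summable_on UNIV"
proof -
  have "(\<lambda>x. (\<Sum>s\<in>I. h1_fun u (x + s) - h1_fun u x)\<^sup>2) summable_on UNIV" if "finite I" for I
    using that
  proof induction
    case (insert s I)
    have "(\<lambda>x. (h1_fun u (x + s) + - h1_fun u x)\<^sup>2) summable_on UNIV"
      using summable_on_translate_iff[of "\<lambda>x. (h1_fun u x)\<^sup>2" s]
      by (intro square_summable_add) (auto simp: h1_fun_square_summable)
    then show ?case using insert square_summable_add by fastforce
  qed simp
  from this[OF finite_nbrs[of 0]] show ?thesis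
    by (simp add: laplacian_def sum_nbrs[where g = "\<lambda>y. h1_fun u y - h1_fun u _"])
qed

lemma uminus_nbrs_0: "(\<lambda>s. - s) ` nbrs 0 = nbrs (0 :: int^'n)"
proof -
  have "(\<lambda>s. - s) ` nbrs 0 \<subseteq> nbrs (0 :: int^'n)" by (auto simp: nbrs_def)
  moreover from image_mono[OF this, of uminus] have "nbrs (0 :: int^'n) \<subseteq> (\<lambda>s. - s) ` nbrs 0"
    by (simp add: image_image)
  ultimately show ?thesis by blast
qed

text \<open>
  Translating the summation index moves the difference from \<open>h\<close> to \<open>u\<close>.  This replaces a
  displacement \<open>s\<close> by \<open>- s\<close>, which the symmetry of the neighbourhood of \<open>0\<close> absorbs; each edge is
  seen from both ends, hence the factor \<open>1 / 2\<close>.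
\<close>

lemma summation_by_parts:
  "(\<Sum>\<^sub>\<infinity>x. 1 / 2 * grad_prod (h1_fun u) (h1_fun h) x) = (\<Sum>\<^sub>\<infinity>x. - laplacian (h1_fun u) x * h1_fun h x)"
proof -
  let ?u = "h1_fun u" and ?h = "h1_fun h"
  define S where "S = (\<Sum>\<^sub>\<infinity>x. ?u x * ?h x)"
  define J where "J s = (\<Sum>\<^sub>\<infinity>x. ?u (x + s) * ?h x)" for s
  have S: "((\<lambda>x. ?u x * ?h x) has_sum S) UNIV"
    unfolding S_def by (rule has_sum_infsum) (rule h1_fun_mult_summable)
  have S': "((\<lambda>x. ?u (x + s) * ?h (x + s)) has_sum S) UNIV" for s
    using has_sum_translate_iff[of "\<lambda>x. ?u x * ?h x" s] S by simp
  have J: "((\<lambda>x. ?u (x + s) * ?h x) has_sum J s) UNIV" for s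
    unfolding J_def using summable_on_translate_iff[of "\<lambda>x. (?u x)\<^sup>2" s]
    by (intro has_sum_infsum square_summable_prod) (auto simp: h1_fun_square_summable)
  have J': "((\<lambda>x. ?u x * ?h (x + s)) has_sum J (- s)) UNIV" for s
    using has_sum_translate_iff[of "\<lambda>x. ?u (x - s) * ?h x" s] J[of "- s"] by simp
  have "((\<lambda>x. \<Sum>s\<in>nbrs 0. (?u (x + s) * ?h (x + s) - ?u (x + s) * ?h x) + (?u x * ?h x - ?u x * ?h (x + s)))
      has_sum (\<Sum>s\<in>nbrs 0. (S - J s) + (S - J (- s)))) UNIV"
    by (intro has_sum_finite_sum finite_nbrs has_sum_add has_sum_minus_real S S' J J')
  also have "(\<lambda>x. \<Sum>s\<in>nbrs 0. (?u (x + s) * ?h (x + s) - ?u (x + s) * ?h x) + (?u x * ?h x - ?u x * ?h (x + s)))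
      = grad_prod ?u ?h"
  proof
    fix x
    have "grad_prod ?u ?h x = (\<Sum>s\<in>nbrs 0. (?u (x + s) - ?u x) * (?h (x + s) - ?h x))"
      by (simp add: grad_prod_def sum_nbrs[of "\<lambda>y. (?u y - ?u x) * (?h y - ?h x)" x])
    then show "(\<Sum>s\<in>nbrs 0. (?u (x + s) * ?h (x + s) - ?u (x + s) * ?h x) + (?u x * ?h x - ?u x * ?h (x + s)))
        = grad_prod ?u ?h x" by (simp add: algebra_simps)
  qed
  also have "(\<Sum>s\<in>nbrs 0. (S - J s) + (S - J (- s))) = (\<Sum>s\<in>nbrs 0. S - J s) + (\<Sum>s\<in>uminus ` nbrs 0. S - J s)"
    unfolding sum.distrib by (simp add: sum.reindex inj_on_def o_def)
  also have "\<dots> = 2 * (\<Sum>s\<in>nbrs (0 :: int^'a). S - J s)" by (simp only: uminus_nbrs_0 mult_2)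
  finally have 1: "(grad_prod ?u ?h has_sum 2 * (\<Sum>s\<in>nbrs 0. S - J s)) UNIV" .
  have "((\<lambda>x. \<Sum>s\<in>nbrs 0. ?u x * ?h x - ?u (x + s) * ?h x) has_sum (\<Sum>s\<in>nbrs 0. S - J s)) UNIV"
    by (intro has_sum_finite_sum finite_nbrs has_sum_minus_real S J)
  also have "(\<lambda>x. \<Sum>s\<in>nbrs 0. ?u x * ?h x - ?u (x + s) * ?h x) = (\<lambda>x. - laplacian ?u x * ?h x)"
    by (rule ext) (simp add: laplacian_def sum_nbrs[where g = "\<lambda>y. ?u y - ?u _"]
        sum_distrib_right sum_negf[symmetric] left_diff_distrib del: sum_subtractf)
  finally have 2: "((\<lambda>x. - laplacian ?u x * ?h x) has_sum (\<Sum>s\<in>nbrs 0. S - J s)) UNIV" .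
  show ?thesis using infsumI[OF has_sum_cmult_right[OF 1, of "1 / 2"]] infsumI[OF 2] by simp
qed

section \<open>The nonlinearity\<close>

locale periodic_superlinear =
  fixes T :: nat
    and V :: "int^'n \<Rightarrow> real"
    and f :: "int^'n \<Rightarrow> real \<Rightarrow> real"
    and a q :: real
  assumes period_pos: "T \<ge> 1"
    and f_continuous: "\<And>x. continuous_on UNIV (f x)"
    and a_pos: "a > 0" and q_gt_2: "q > 2"
    and growth: "\<And>x u. \<bar>f x u\<bar> \<le> a * (\<bar>u\<bar> + \<bar>u\<bar> powr (q - 1))"
    and V_periodic: "periodic T V" and f_periodic: "\<And>u. periodic T (\<lambda>x. f x u)"
    and V_pos: "\<And>x. V x > 0"
    and f_small: "uniform_limit UNIV (\<lambda>u x. f x u / u) (\<lambda>_. 0) (at 0)"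
    and f_mono_neg: "\<And>x. strict_mono_on {..<0} (\<lambda>u. f x u / \<bar>u\<bar>)"
    and f_mono_pos: "\<And>x. strict_mono_on {0<..} (\<lambda>u. f x u / \<bar>u\<bar>)"
    and superquadratic: "\<And>B. \<forall>\<^sub>F u in at_infinity. \<forall>x. primitive f x u / u\<^sup>2 \<ge> B"
begin

abbreviation F :: "int^'n \<Rightarrow> real \<Rightarrow> real" where "F \<equiv> primitive f"
abbreviation E :: "'n h1 \<Rightarrow> real" where "E \<equiv> energy V f"

lemma f_0: "f x 0 = 0"
  using growth[of x 0] by simp

lemma F_0: "F x 0 = 0"
  by (simp add: primitive_def flip: zero_ereal_def)

lemma F_deriv: "(F x has_real_derivative f x u) (at u)"
proof -
  let ?d = "- \<bar>u\<bar> - 1" and ?e = "\<bar>u\<bar> + 1"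
  have "((\<lambda>u. LBINT y=ereal 0..ereal u. f x y) has_vector_derivative f x u) (at u within {?d..?e})"
    by (rule interval_integral_FTC2) (auto intro: continuous_on_subset[OF f_continuous])
  then have "((\<lambda>u. LBINT y=ereal 0..ereal u. f x y) has_vector_derivative f x u) (at u within {?d<..<?e})"
    by (rule has_vector_derivative_within_subset) auto
  then have "((\<lambda>u. LBINT y=ereal 0..ereal u. f x y) has_vector_derivative f x u) (at u)"
    by (subst (asm) has_vector_derivative_within_open) auto
  then show ?thesis
    unfolding has_real_derivative_iff_has_vector_derivative primitive_def[abs_def] zero_ereal_def .
qed

lemma F_deriv_scaled:
  "((\<lambda>t. F x (p + t * r)) has_real_derivative f x (p + t * r) * r) (at t)"
  by (auto intro!: DERIV_chain2[OF F_deriv] derivative_eq_intros)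

lemma F_mean_value:
  obtains z where "0 < z" "z < 1" "F x (p + r) - F x p = f x (p + z * r) * r"
proof -
  obtain z where "0 < z" "z < 1"
    "F x (p + 1 * r) - F x (p + 0 * r) = (1 - 0) * (f x (p + z * r) * r)"
    using MVT2[of 0 1 "\<lambda>t. F x (p + t * r)" "\<lambda>t. f x (p + t * r) * r"] F_deriv_scaled by auto
  then show ?thesis using that by simp
qed

lemma f_little_o:
  assumes "0 < e"
  shows "\<exists>d>0. \<forall>x u. \<bar>u\<bar> \<le> d \<longrightarrow> \<bar>f x u\<bar> \<le> e * \<bar>u\<bar>"
proof -
  have "\<forall>\<^sub>F u in at 0. \<forall>x\<in>UNIV. dist (f x u / u) 0 < e"
    using f_small assms by (rule uniform_limitD)
  then obtain d where d: "0 < d" "\<And>u x. u \<noteq> 0 \<Longrightarrow> \<bar>u\<bar> < d \<Longrightarrow> \<bar>f x u / u\<bar> < e"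
    unfolding eventually_at by (auto simp: dist_real_def)
  have "\<bar>f x u\<bar> \<le> e * \<bar>u\<bar>" if "\<bar>u\<bar> \<le> d / 2" for x u
  proof (cases "u = 0")
    case False
    then have "\<bar>f x u / u\<bar> < e" using d(1) that by (intro d(2)) auto
    then show ?thesis using False by (simp add: abs_divide field_simps)
  qed (simp add: f_0)
  then show ?thesis using d(1) by (intro exI[of _ "d / 2"]) auto
qed

lemma f_linear_bound: "\<exists>C\<ge>0. \<forall>x u. \<bar>u\<bar> \<le> R \<longrightarrow> \<bar>f x u\<bar> \<le> C * \<bar>u\<bar>"
proof (intro exI[of _ "a * (1 + \<bar>R\<bar> powr (q - 2))"] conjI allI impI)
  show "0 \<le> a * (1 + \<bar>R\<bar> powr (q - 2))" using a_pos by simp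
  fix x u assume u: "\<bar>u\<bar> \<le> R"
  have "\<bar>u\<bar> powr (q - 1) = \<bar>u\<bar> powr (q - 2) * \<bar>u\<bar>"
  proof (cases "u = 0")
    case False
    then show ?thesis using powr_add[of "\<bar>u\<bar>" "q - 2" 1] by simp
  qed simp
  also have "\<dots> \<le> \<bar>R\<bar> powr (q - 2) * \<bar>u\<bar>"
    using u q_gt_2 by (intro mult_right_mono powr_mono2) auto
  finally have "a * (\<bar>u\<bar> + \<bar>u\<bar> powr (q - 1)) \<le> a * (\<bar>u\<bar> + \<bar>R\<bar> powr (q - 2) * \<bar>u\<bar>)"
    using a_pos by simp
  then show "\<bar>f x u\<bar> \<le> a * (1 + \<bar>R\<bar> powr (q - 2)) * \<bar>u\<bar>"
    using growth[of x u] by (simp add: algebra_simps)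
qed

text \<open>
  Both monotonicity hypotheses in one inequality: \<open>t \<mapsto> f x (t * u) * u / t\<close> is strictly increasing.
\<close>

lemma f_scaling_strict:
  assumes "u \<noteq> 0" "0 < s" "s < t"
  shows "t * (f x (s * u) * u) < s * (f x (t * u) * u)"
proof (cases "0 < u")
  case True
  then have "f x (s * u) / \<bar>s * u\<bar> < f x (t * u) / \<bar>t * u\<bar>"
    using assms by (intro strict_mono_onD[OF f_mono_pos]) auto
  then have "t * f x (s * u) < s * f x (t * u)"
    using True assms by (simp add: abs_mult field_simps)
  then show ?thesis using True by (simp flip: mult.assoc)
next
  case False
  then have u: "u < 0" using assms by simp
  then have "f x (t * u) / \<bar>t * u\<bar> < f x (s * u) / \<bar>s * u\<bar>"
    using assms by (intro strict_mono_onD[OF f_mono_neg]) (auto simp: mult_pos_neg)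
  moreover obtain w where w: "0 < w" "\<bar>s * u\<bar> = s * w" "\<bar>t * u\<bar> = t * w"
    using u assms by (intro that[of "- u"]) (auto simp: abs_mult)
  ultimately have "f x (t * u) / (t * w) < f x (s * u) / (s * w)" by simp
  then have "s * f x (t * u) < t * f x (s * u)"
    using assms w(1) by (simp add: field_simps)
  then show ?thesis using u by (simp flip: mult.assoc)
qed

text \<open>The quotient \<open>f x (t * u) * u / t\<close> increases from its limit \<open>0\<close> at \<open>t = 0\<close>.\<close>

lemma f_sign: "0 \<le> f x u * u"
proof (rule ccontr)
  assume neg: "\<not> 0 \<le> f x u * u"
  then have u: "u \<noteq> 0" by auto
  define e where "e = \<bar>f x u\<bar> / \<bar>u\<bar>"
  have eu: "e * \<bar>u\<bar> = \<bar>f x u\<bar>" using u by (simp add: e_def)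
  have "e * u\<^sup>2 = (e * \<bar>u\<bar>) * \<bar>u\<bar>" by (simp add: power2_eq_square mult.assoc)
  also have "\<dots> = \<bar>f x u * u\<bar>" by (simp only: eu abs_mult)
  finally have fu: "f x u * u = - (e * u\<^sup>2)" using neg by simp
  have "f x u \<noteq> 0" using neg by auto
  then have e: "0 < e" using u by (simp add: e_def)
  obtain d where d: "0 < d" "\<And>x u. \<bar>u\<bar> \<le> d \<Longrightarrow> \<bar>f x u\<bar> \<le> e * \<bar>u\<bar>"
    using f_little_o[OF e] by blast
  \<comment> \<open>Small enough for the bound with slope \<open>e\<close> at \<open>t * u\<close>, and less than \<open>1\<close>, so that the quotient lies below its value \<open>- e * u\<^sup>2\<close> at \<open>1\<close>.\<close>
  define t where "t = min (1 / 2) (d / \<bar>u\<bar>)"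
  have t: "0 < t" "t < 1" "\<bar>t * u\<bar> \<le> d"
    using u d(1) by (auto simp: t_def abs_mult min_def field_simps)
  have "f x (t * u) * u < - (t * (e * u\<^sup>2))"
    using f_scaling_strict[OF u t(1,2), of x] fu by simp
  moreover have "\<bar>f x (t * u) * u\<bar> \<le> t * (e * u\<^sup>2)"
  proof -
    have "\<bar>f x (t * u)\<bar> * \<bar>u\<bar> \<le> e * \<bar>t * u\<bar> * \<bar>u\<bar>" by (intro mult_right_mono d t) auto
    also have "\<dots> = t * (e * (\<bar>u\<bar> * \<bar>u\<bar>))" using t(1) by (simp add: abs_mult)
    finally show ?thesis by (simp add: abs_mult power2_eq_square)
  qed
  ultimately show False by linarith
qed

lemma F_nonneg: "0 \<le> F x u"
proof -
  obtain z where z: "0 < z" "F x (0 + u) - F x 0 = f x (0 + z * u) * u"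
    by (rule F_mean_value)
  have "0 \<le> f x (z * u) * (z * u)" by (rule f_sign)
  then have "0 \<le> z * F x u" using z(2) F_0[of x] by (simp add: mult_ac)
  then show ?thesis using z(1) by (simp add: zero_le_mult_iff)
qed

text \<open>
  As a function of \<open>t\<^sup>2\<close>, \<open>F x (t * u)\<close> is strictly convex, and the right hand side is its tangent
  at \<open>t = 1\<close>.  This inequality is what makes every ray meet the Nehari set in a strict maximum of
  the energy.
\<close>

lemma F_above_tangent:
  assumes u: "u \<noteq> 0" and t: "0 \<le> t" "t \<noteq> 1"
  shows "(t\<^sup>2 - 1) / 2 * (f x u * u) < F x (t * u) - F x u"
proof -
  define h where "h t = F x (t * u) - t\<^sup>2 / 2 * (f x u * u)" for t
  have d: "(h has_real_derivative f x (t * u) * u - t * (f x u * u)) (at t)" for t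
    unfolding h_def using F_deriv_scaled[of x 0 u t]
    by (auto intro!: derivative_eq_intros)
  then have cont: "continuous_on S h" for S
    by (meson DERIV_isCont continuous_at_imp_continuous_on)
  have "h 1 < h t"
  proof (cases "t < 1")
    case True
    show ?thesis
    proof (rule DERIV_neg_imp_decreasing_open[OF True _ cont])
      fix s assume s: "t < s" "s < 1"
      then show "\<exists>y. (h has_real_derivative y) (at s) \<and> y < 0"
        using f_scaling_strict[OF u, of s 1 x] t(1) d by (intro exI conjI[OF d]) auto
    qed
  next
    case False
    then have "1 < t" using t by simp
    then show ?thesis
    proof (rule DERIV_pos_imp_increasing_open[OF _ _ cont])
      fix s assume s: "1 < s" "s < t"
      then show "\<exists>y. (h has_real_derivative y) (at s) \<and> 0 < y"
        using f_scaling_strict[OF u, of 1 s x] d by (intro exI conjI[OF d]) auto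
    qed
  qed
  then show ?thesis unfolding h_def by (simp add: field_simps)
qed

text \<open>
  Two tangents at \<open>t * u\<close>, evaluated at \<open>0\<close> and at \<open>u\<close>: a convex function of \<open>t\<^sup>2\<close> that vanishes at
  \<open>0\<close> lies below its chord.
\<close>

lemma F_le_square_scaling:
  assumes "0 \<le> t" "t \<le> 1"
  shows "F x (t * u) \<le> t\<^sup>2 * F x u"
proof (cases "u = 0 \<or> t = 0 \<or> t = 1")
  case True
  then show ?thesis by (auto simp: F_0)
next
  case False
  then have tu: "t * u \<noteq> 0" and t: "0 < t" "t < 1" using assms by auto
  let ?P = "f x (t * u) * (t * u)"
  have "F x (t * u) < ?P / 2" using F_above_tangent[OF tu, of 0 x] by (simp add: F_0)
  moreover have "((1 / t)\<^sup>2 - 1) / 2 * ?P < F x u - F x (t * u)"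
    using F_above_tangent[OF tu, of "1 / t" x] t by simp
  moreover have "0 \<le> (1 / t)\<^sup>2 - 1" using t by (simp add: power2_eq_square field_simps mult_le_one)
  ultimately have "((1 / t)\<^sup>2 - 1) * F x (t * u) \<le> F x u - F x (t * u)"
    using mult_left_mono[of "F x (t * u)" "?P / 2" "(1 / t)\<^sup>2 - 1"] by simp
  then have "(1 / t)\<^sup>2 * F x (t * u) \<le> F x u" by (simp add: algebra_simps)
  then show ?thesis using t by (simp add: power2_eq_square field_simps)
qed

lemma F_le_quadratic:
  assumes "\<And>v. \<bar>v\<bar> \<le> R \<Longrightarrow> \<bar>f x v\<bar> \<le> C * \<bar>v\<bar>" "\<bar>u\<bar> \<le> R" "0 \<le> C"
  shows "F x u \<le> C * u\<^sup>2"
proof -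
  obtain z where z: "0 < z" "z < 1" "F x (0 + u) - F x 0 = f x (0 + z * u) * u"
    by (rule F_mean_value)
  have zu: "\<bar>z * u\<bar> \<le> \<bar>u\<bar>" using z by (simp add: abs_mult mult_left_le_one_le)
  have "F x u \<le> \<bar>f x (z * u)\<bar> * \<bar>u\<bar>" using z(3) F_0[of x] by (simp flip: abs_mult)
  also have "\<dots> \<le> (C * \<bar>z * u\<bar>) * \<bar>u\<bar>" using zu assms by (intro mult_right_mono) auto
  also have "\<dots> \<le> (C * \<bar>u\<bar>) * \<bar>u\<bar>" using zu assms(3) by (intro mult_right_mono mult_left_mono) auto
  finally show ?thesis by (simp add: power2_eq_square)
qed

text \<open>
  Suppose \<open>\<bar>r\<bar> \<le> \<bar>p\<bar>\<close>.  By the mean value theorem \<open>F x (p + r) - F x p\<close> is of order \<open>\<bar>p\<bar> * \<bar>r\<bar>\<close>, and so is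
  \<open>F x r\<close>, being of order \<open>r\<^sup>2\<close>.  This is the Brezis--Lieb splitting of the potential energy in a
  pointwise form.
\<close>

lemma F_interaction: "\<exists>C\<ge>0. \<forall>x p r. \<bar>p\<bar> \<le> R \<longrightarrow> \<bar>r\<bar> \<le> R \<longrightarrow> \<bar>F x (p + r) - F x p - F x r\<bar> \<le> C * \<bar>p * r\<bar>"
proof -
  obtain C where C: "0 \<le> C" "\<And>x u. \<bar>u\<bar> \<le> 2 * R \<Longrightarrow> \<bar>f x u\<bar> \<le> C * \<bar>u\<bar>"
    using f_linear_bound[of "2 * R"] by blast
  have *: "\<bar>F x (p + r) - F x p - F x r\<bar> \<le> 3 * C * \<bar>p * r\<bar>" if "\<bar>p\<bar> \<le> R" "\<bar>r\<bar> \<le> \<bar>p\<bar>" for x p r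
  proof -
    obtain z where z: "0 < z" "z < 1" "F x (p + r) - F x p = f x (p + z * r) * r"
      by (rule F_mean_value)
    have "\<bar>z * r\<bar> \<le> \<bar>r\<bar>" using z by (simp add: abs_mult mult_left_le_one_le)
    then have pz: "\<bar>p + z * r\<bar> \<le> 2 * \<bar>p\<bar>" using that by linarith
    have "\<bar>f x (p + z * r)\<bar> \<le> C * \<bar>p + z * r\<bar>" using pz that by (intro C) auto
    also have "\<dots> \<le> C * (2 * \<bar>p\<bar>)" using pz C(1) by (rule mult_left_mono)
    finally have "\<bar>f x (p + z * r) * r\<bar> \<le> C * (2 * \<bar>p\<bar>) * \<bar>r\<bar>"
      unfolding abs_mult by (rule mult_right_mono) simp
    moreover have "F x r \<le> C * \<bar>r\<bar>\<^sup>2"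
      using F_le_quadratic[of "2 * R" x C r] C that by simp
    moreover have "C * \<bar>r\<bar>\<^sup>2 \<le> C * \<bar>p\<bar> * \<bar>r\<bar>"
      unfolding power2_eq_square mult.assoc using that C(1) by (intro mult_left_mono mult_right_mono) auto
    moreover have "C * (2 * \<bar>p\<bar>) * \<bar>r\<bar> = 2 * (C * \<bar>p\<bar> * \<bar>r\<bar>)"
      "3 * C * \<bar>p * r\<bar> = 3 * (C * \<bar>p\<bar> * \<bar>r\<bar>)" by (auto simp: abs_mult)
    ultimately show ?thesis using z(3) F_nonneg[of x r] by linarith
  qed
  show ?thesis
  proof (intro exI[of _ "3 * C"] conjI allI impI)
    fix x p r assume "\<bar>p\<bar> \<le> R" "\<bar>r\<bar> \<le> R"
    then show "\<bar>F x (p + r) - F x p - F x r\<bar> \<le> 3 * C * \<bar>p * r\<bar>"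
      using *[of p r x] *[of r p x] by (cases "\<bar>r\<bar> \<le> \<bar>p\<bar>") (auto simp: add.commute mult.commute algebra_simps)
  qed (use C in simp)
qed

lemma F_superquadratic: "\<exists>K>0. \<forall>x u. K \<le> \<bar>u\<bar> \<longrightarrow> B * u\<^sup>2 \<le> F x u"
proof -
  obtain b where b: "\<And>u x. b \<le> \<bar>u\<bar> \<Longrightarrow> B \<le> F x u / u\<^sup>2"
    using superquadratic[of B] by (auto simp: eventually_at_infinity)
  have "B * u\<^sup>2 \<le> F x u" if "max b 1 \<le> \<bar>u\<bar>" for x u
    using b[of u x] that by (auto simp: field_simps)
  then show ?thesis by (intro exI[of _ "max b 1"]) auto
qed

section \<open>Periodicity\<close>

lemma periodic_translate:
  assumes "periodic T g"
  shows "g (x + (\<chi> i. int T * k $ i)) = g x"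
proof -
  have nat_mult: "g (x + axis i (int T * int m)) = g x" for x i m
  proof (induction m)
    case (Suc m)
    have "x + axis i (int T * int (Suc m)) = (x + axis i (int T * int m)) + axis i (int T)"
      by (simp add: vec_eq_iff axis_def algebra_simps)
    then show ?case using assms Suc unfolding periodic_def by metis
  qed (simp add: axis_def flip: zero_vec_def)
  have int_mult: "g (x + axis i (int T * m)) = g x" for x i m
  proof (cases "0 \<le> m")
    case True
    then show ?thesis using nat_mult[of x i "nat m"] by simp
  next
    case False
    then have "x = (x + axis i (int T * m)) + axis i (int T * int (nat (- m)))"
      by (simp add: vec_eq_iff axis_def)
    then show ?thesis using nat_mult by metis
  qed
  have "g (x + (\<Sum>i\<in>I. axis i (int T * k $ i))) = g x" if "finite I" for I x
    using that
  proof (induction I arbitrary: x)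
    case (insert i I)
    then show ?case using int_mult by (simp flip: add.assoc)
  qed simp
  moreover have "(\<Sum>i\<in>UNIV. axis i (int T * k $ i)) = (\<chi> i. int T * k $ i)"
    by (simp add: vec_eq_iff axis_def if_distrib sum.delta cong: if_cong)
  ultimately show ?thesis by (metis finite_class.finite_UNIV)
qed

definition period_cell :: "(int^'n) set" where
  "period_cell = {y. \<forall>i. 0 \<le> y $ i \<and> y $ i < int T}"

lemma finite_period_cell: "finite period_cell"
proof -
  have "period_cell \<subseteq> (\<lambda>f. (\<chi> i. f i) :: int^'n) ` (UNIV \<rightarrow>\<^sub>E {0..<int T})"
  proof
    fix s assume "s \<in> period_cell"
    then show "s \<in> (\<lambda>f. (\<chi> i. f i) :: int^'n) ` (UNIV \<rightarrow>\<^sub>E {0..<int T})"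
      by (intro image_eqI[of _ _ "\<lambda>i. s $ i"]) (auto simp: vec_eq_iff period_cell_def)
  qed
  then show ?thesis by (rule finite_subset) (auto intro!: finite_imageI finite_PiE)
qed

lemma translate_into_period_cell: "\<exists>k. x + (\<chi> i. int T * k $ i) \<in> period_cell"
proof
  have "x $ i + int T * - (x $ i div int T) = x $ i mod int T" for i
    by (simp add: minus_mult_div_eq_mod[symmetric])
  then show "x + (\<chi> i. int T * (\<chi> i. - (x $ i div int T)) $ i) \<in> period_cell"
    using period_pos by (simp add: period_cell_def)
qed

text \<open>
  By periodicity all values of \<open>V\<close> are attained on the finite cell.
\<close>

lemma V_bounds: obtains \<alpha> \<beta> where "0 < \<alpha>" "\<And>x. \<alpha> \<le> V x" "\<And>x. V x \<le> \<beta>"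
proof -
  have "V x \<in> V ` period_cell" for x
    using translate_into_period_cell[of x] periodic_translate[OF V_periodic] by (metis imageI)
  then have "\<And>x. Min (V ` period_cell) \<le> V x" "\<And>x. V x \<le> Max (V ` period_cell)" "V ` period_cell \<noteq> {}"
    using finite_period_cell by auto
  moreover from this have "0 < Min (V ` period_cell)"
    using finite_period_cell V_pos by simp
  ultimately show ?thesis using that by blast
qed

section \<open>The quadratic part of the energy\<close>

definition quad :: "'n h1 \<Rightarrow> real" where
  "quad u = (\<Sum>\<^sub>\<infinity>x. 1 / 2 * grad_sq (h1_fun u) x + V x * (h1_fun u x)\<^sup>2)"

definition schroedinger :: "'n h1 \<Rightarrow> int^'n \<Rightarrow> real" where
  "schroedinger u x = - laplacian (h1_fun u) x + V x * h1_fun u x"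

definition potential :: "'n h1 \<Rightarrow> real" where
  "potential u = (\<Sum>\<^sub>\<infinity>x. F x (h1_fun u x))"

lemma energy_split: "E u = 1 / 2 * quad u - potential u"
  by (simp add: energy_def quad_def potential_def grad_sq_def)

lemma V_mult_summable:
  assumes "g summable_on UNIV"
  shows "(\<lambda>x. V x * g x) summable_on UNIV"
proof -
  obtain \<alpha> \<beta> where V: "0 < \<alpha>" "\<And>x. \<alpha> \<le> V x" "\<And>x. V x \<le> \<beta>" using V_bounds by blast
  have "(\<lambda>x. \<beta> * \<bar>g x\<bar>) summable_on UNIV"
    using assms summable_on_iff_abs_summable_on_real[of g UNIV] by (intro summable_on_cmult_right) simp
  then show ?thesis
    by (rule summable_on_real_bound(1)) (simp add: abs_mult V(3) less_imp_le[OF V_pos] mult_right_mono)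
qed

lemma quad_summable: "(\<lambda>x. 1 / 2 * grad_sq (h1_fun u) x + V x * (h1_fun u x)\<^sup>2) summable_on UNIV"
  by (intro summable_on_add summable_on_cmult_right h1_fun_grad_sq_summable V_mult_summable h1_fun_square_summable)

text \<open>The quadratic part is the square of an equivalent norm.\<close>

lemma quad_bounds:
  obtains \<alpha> \<beta> where "0 < \<alpha>" "0 < \<beta>" "\<And>u. \<alpha> * (norm u)\<^sup>2 \<le> quad u" "\<And>u. quad u \<le> \<beta> * (norm u)\<^sup>2"
proof -
  obtain \<alpha> \<beta> where V: "0 < \<alpha>" "\<And>x. \<alpha> \<le> V x" "\<And>x. V x \<le> \<beta>" using V_bounds by blast
  have "min \<alpha> 1 * (norm u)\<^sup>2 \<le> quad u" for u
    unfolding h1_norm_sq(1) quad_def infsum_cmult_right'[symmetric]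
  proof (intro infsum_mono summable_on_cmult_right h1_norm_sq(2) quad_summable)
    fix x
    have "min \<alpha> 1 * (1 / 2 * grad_sq (h1_fun u) x) \<le> 1 * (1 / 2 * grad_sq (h1_fun u) x)"
      "min \<alpha> 1 * (h1_fun u x)\<^sup>2 \<le> V x * (h1_fun u x)\<^sup>2"
      using V(2)[of x] by (intro mult_right_mono; simp add: grad_sq_nonneg)+
    then show "min \<alpha> 1 * (1 / 2 * grad_sq (h1_fun u) x + (h1_fun u x)\<^sup>2)
      \<le> 1 / 2 * grad_sq (h1_fun u) x + V x * (h1_fun u x)\<^sup>2" by (simp add: distrib_left)
  qed
  moreover have "quad u \<le> max \<beta> 1 * (norm u)\<^sup>2" for u
    unfolding h1_norm_sq(1) quad_def infsum_cmult_right'[symmetric]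
  proof (intro infsum_mono summable_on_cmult_right h1_norm_sq(2) quad_summable)
    fix x
    have "1 * (1 / 2 * grad_sq (h1_fun u) x) \<le> max \<beta> 1 * (1 / 2 * grad_sq (h1_fun u) x)"
      "V x * (h1_fun u x)\<^sup>2 \<le> max \<beta> 1 * (h1_fun u x)\<^sup>2"
      using V(3)[of x] by (intro mult_right_mono; simp add: grad_sq_nonneg)+
    then show "1 / 2 * grad_sq (h1_fun u) x + V x * (h1_fun u x)\<^sup>2
      \<le> max \<beta> 1 * (1 / 2 * grad_sq (h1_fun u) x + (h1_fun u x)\<^sup>2)" by (simp add: distrib_left)
  qed
  ultimately show ?thesis using V(1) by (intro that[of "min \<alpha> 1" "max \<beta> 1"]) auto
qed

lemma schroedinger_square_summable: "(\<lambda>x. (schroedinger u x)\<^sup>2) summable_on UNIV"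
proof -
  have "(\<lambda>x. V x * (V x * (h1_fun u x)\<^sup>2)) summable_on UNIV"
    by (intro V_mult_summable h1_fun_square_summable)
  then have "(\<lambda>x. (V x * h1_fun u x)\<^sup>2) summable_on UNIV"
    by (simp add: power2_eq_square mult_ac)
  moreover have "(\<lambda>x. (- laplacian (h1_fun u) x)\<^sup>2) summable_on UNIV"
    using laplacian_square_summable[of u] by simp
  ultimately show ?thesis unfolding schroedinger_def by (rule square_summable_add[rotated])
qed

lemma schroedinger_mult_summable: "(\<lambda>x. schroedinger u x * h1_fun h x) summable_on UNIV"
  by (intro square_summable_prod schroedinger_square_summable h1_fun_square_summable)

lemma schroedinger_pairing:
  "(\<Sum>\<^sub>\<infinity>x. schroedinger u x * h1_fun h x)
    = (\<Sum>\<^sub>\<infinity>x. 1 / 2 * grad_prod (h1_fun u) (h1_fun h) x + V x * (h1_fun u x * h1_fun h x))"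
proof -
  have L: "(\<lambda>x. - laplacian (h1_fun u) x * h1_fun h x) summable_on UNIV"
    using laplacian_square_summable[of u] by (intro square_summable_prod h1_fun_square_summable) simp
  have W: "(\<lambda>x. V x * (h1_fun u x * h1_fun h x)) summable_on UNIV"
    by (intro V_mult_summable h1_fun_mult_summable)
  have G: "(\<lambda>x. 1 / 2 * grad_prod (h1_fun u) (h1_fun h) x) summable_on UNIV"
    by (intro summable_on_cmult_right h1_fun_grad_prod_summable)
  have "(\<Sum>\<^sub>\<infinity>x. schroedinger u x * h1_fun h x)
      = (\<Sum>\<^sub>\<infinity>x. - laplacian (h1_fun u) x * h1_fun h x + V x * (h1_fun u x * h1_fun h x))"
    by (simp add: schroedinger_def algebra_simps)
  also have "\<dots> = (\<Sum>\<^sub>\<infinity>x. 1 / 2 * grad_prod (h1_fun u) (h1_fun h) x + V x * (h1_fun u x * h1_fun h x))"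
    by (simp only: infsum_add[OF L W] infsum_add[OF G W] summation_by_parts)
  finally show ?thesis .
qed

lemma quad_pairing: "quad u = (\<Sum>\<^sub>\<infinity>x. schroedinger u x * h1_fun u x)"
  by (simp only: quad_def schroedinger_pairing grad_prod_self power2_eq_square)

text \<open>
  The operator \<open>- \<Delta> + V\<close> represents the bilinear form of \<open>quad\<close>.
\<close>

lemma quad_add: "quad (u + h) = quad u + 2 * (\<Sum>\<^sub>\<infinity>x. schroedinger u x * h1_fun h x) + quad h"
proof -
  have W: "(\<lambda>x. 1 / 2 * grad_prod (h1_fun u) (h1_fun h) x + V x * (h1_fun u x * h1_fun h x)) summable_on UNIV"
    by (intro summable_on_add summable_on_cmult_right V_mult_summable h1_fun_mult_summable h1_fun_grad_prod_summable)
  note W2 = summable_on_cmult_right[OF W, of 2]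
  have "grad_sq (h1_fun (u + h)) x = grad_sq (h1_fun u) x + 2 * grad_prod (h1_fun u) (h1_fun h) x + grad_sq (h1_fun h) x" for x
    unfolding grad_sq_def grad_prod_def plus_h1.rep_eq sum_distrib_left sum.distrib[symmetric]
    by (intro sum.cong) (auto simp: power2_eq_square algebra_simps)
  then have "quad (u + h) = (\<Sum>\<^sub>\<infinity>x. (1 / 2 * grad_sq (h1_fun u) x + V x * (h1_fun u x)\<^sup>2)
      + 2 * (1 / 2 * grad_prod (h1_fun u) (h1_fun h) x + V x * (h1_fun u x * h1_fun h x))
      + (1 / 2 * grad_sq (h1_fun h) x + V x * (h1_fun h x)\<^sup>2))"
    unfolding quad_def by (intro infsum_cong) (simp add: plus_h1.rep_eq power2_eq_square algebra_simps)
  also have "\<dots> = quad u + 2 * (\<Sum>\<^sub>\<infinity>x. schroedinger u x * h1_fun h x) + quad h"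
    by (simp only: infsum_add[OF summable_on_add[OF quad_summable[of u] W2] quad_summable[of h]]
        infsum_add[OF quad_summable[of u] W2] quad_def schroedinger_pairing infsum_cmult_right')
  finally show ?thesis .
qed

lemma quad_scaleR: "quad (t *\<^sub>R u) = t\<^sup>2 * quad u"
proof -
  have "grad_sq (h1_fun (t *\<^sub>R u)) x = t\<^sup>2 * grad_sq (h1_fun u) x" for x
    unfolding grad_sq_def scaleR_h1.rep_eq sum_distrib_left
    by (intro sum.cong) (auto simp: power2_eq_square algebra_simps)
  then show ?thesis
    unfolding quad_def infsum_cmult_right'[symmetric]
    by (intro infsum_cong) (simp add: scaleR_h1.rep_eq power_mult_distrib algebra_simps)
qed

section \<open>The potential part and the derivative of the energy\<close>

lemma f_bound_on_range:
  "\<exists>C\<ge>0. \<forall>u::'n h1. norm u \<le> R \<longrightarrow> (\<forall>x. \<bar>f x (h1_fun u x)\<bar> \<le> C * \<bar>h1_fun u x\<bar> \<and> F x (h1_fun u x) \<le> C * (h1_fun u x)\<^sup>2)"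
proof -
  obtain C where C: "0 \<le> C" "\<And>x u. \<bar>u\<bar> \<le> R \<Longrightarrow> \<bar>f x u\<bar> \<le> C * \<bar>u\<bar>"
    using f_linear_bound[of R] by blast
  show ?thesis
  proof (intro exI[of _ C] conjI allI impI C(1))
    fix u :: "'n h1" and x assume "norm u \<le> R"
    then have R: "\<bar>h1_fun u x\<bar> \<le> R" using h1_fun_le_norm[of u x] by linarith
    show "\<bar>f x (h1_fun u x)\<bar> \<le> C * \<bar>h1_fun u x\<bar>" by (rule C(2)[OF R])
    show "F x (h1_fun u x) \<le> C * (h1_fun u x)\<^sup>2" by (rule F_le_quadratic[OF C(2) R C(1)])
  qed
qed

lemma potential_summable: "(\<lambda>x. F x (h1_fun u x)) summable_on UNIV"
proof -
  obtain C where C: "0 \<le> C" "\<And>x. F x (h1_fun u x) \<le> C * (h1_fun u x)\<^sup>2"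
    using f_bound_on_range[of "norm u"] by blast
  have "(\<lambda>x. C * (h1_fun u x)\<^sup>2) summable_on UNIV"
    by (intro summable_on_cmult_right h1_fun_square_summable)
  then show ?thesis by (rule summable_on_real_bound(1)) (simp add: F_nonneg C)
qed

lemma f_square_summable: "(\<lambda>x. (f x (h1_fun u x))\<^sup>2) summable_on UNIV"
proof -
  obtain C where C: "0 \<le> C" "\<And>x. \<bar>f x (h1_fun u x)\<bar> \<le> C * \<bar>h1_fun u x\<bar>"
    using f_bound_on_range[of "norm u"] by blast
  have "(\<lambda>x. C\<^sup>2 * (h1_fun u x)\<^sup>2) summable_on UNIV"
    by (intro summable_on_cmult_right h1_fun_square_summable)
  then show ?thesis
  proof (rule summable_on_real_bound(1))
    fix x
    have "\<bar>f x (h1_fun u x)\<bar>\<^sup>2 \<le> (C * \<bar>h1_fun u x\<bar>)\<^sup>2" using C(2) by (intro power_mono) auto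
    then show "\<bar>(f x (h1_fun u x))\<^sup>2\<bar> \<le> C\<^sup>2 * (h1_fun u x)\<^sup>2" by (simp add: power_mult_distrib)
  qed
qed

lemma f_mult_summable: "(\<lambda>x. f x (h1_fun u x) * h1_fun h x) summable_on UNIV"
  by (intro square_summable_prod f_square_summable h1_fun_square_summable)

lemma potential_nonneg: "0 \<le> potential u"
  unfolding potential_def by (intro infsum_nonneg F_nonneg)

lemma potential_ge_term: "F x (h1_fun u x) \<le> potential u"
  using finite_sum_le_infsum[OF potential_summable[of u], of "{x}"] by (simp add: potential_def F_nonneg)

text \<open>
  The first order remainder of the potential energy is small at finitely many points because \<open>F\<close> is
  differentiable there, and at all others because \<open>u\<close> and \<open>h\<close> are small, where \<open>f\<close> is of lower order.
\<close>

lemma potential_remainder: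
  assumes e: "0 < e"
  shows "\<exists>d>0. \<forall>h. norm h < d \<longrightarrow>
    \<bar>potential (u + h) - potential u - (\<Sum>\<^sub>\<infinity>x. f x (h1_fun u x) * h1_fun h x)\<bar> \<le> e * norm h"
proof -
  let ?u = "h1_fun u"
  \<comment> \<open>Slopes for the two regions, chosen so that each contributes at most \<open>e / 2 * norm h\<close> when \<open>norm h \<le> 1\<close>.\<close>
  define e0 where "e0 = e / (4 * (norm u + 1))"
  have e0: "0 < e0" using e by (simp add: e0_def add_nonneg_pos)
  obtain d0 where d0: "0 < d0" "\<And>x v. \<bar>v\<bar> \<le> d0 \<Longrightarrow> \<bar>f x v\<bar> \<le> e0 * \<bar>v\<bar>"
    using f_little_o[OF e0] by blast
  define A where "A = {x. d0 / 2 \<le> \<bar>?u x\<bar>}"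
  have A: "finite A" unfolding A_def
    by (rule square_summable_finite_ge[OF h1_fun_square_summable]) (use d0 in simp)
  define e1 where "e1 = e / (2 * (real (card A) + 1))"
  have e1: "0 < e1" using e by (simp add: e1_def add_nonneg_pos)
  have "\<forall>x\<in>A. \<forall>\<^sub>F y in nhds 0. \<bar>F x (?u x + y) - F x (?u x) - f x (?u x) * y\<bar> \<le> e1 * \<bar>y\<bar>"
  proof
    fix x
    have "(F x has_derivative (*) (f x (?u x))) (at (?u x))"
      using F_deriv[of x "?u x"] by (simp add: has_field_derivative_def)
    then obtain d where d: "0 < d" "\<And>y. norm (y - ?u x) < d \<Longrightarrow>
        norm (F x y - F x (?u x) - f x (?u x) * (y - ?u x)) \<le> e1 * norm (y - ?u x)"
      using e1 unfolding has_derivative_at_alt by blast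
    show "\<forall>\<^sub>F y in nhds 0. \<bar>F x (?u x + y) - F x (?u x) - f x (?u x) * y\<bar> \<le> e1 * \<bar>y\<bar>"
      unfolding eventually_nhds_metric
      using d(1) d(2)[of "?u x + _"] by (intro exI[of _ d]) (auto simp: dist_real_def)
  qed
  from eventually_ball_finite[OF A this] obtain d1 where d1: "0 < d1"
    "\<And>x y. x \<in> A \<Longrightarrow> \<bar>y\<bar> < d1 \<Longrightarrow> \<bar>F x (?u x + y) - F x (?u x) - f x (?u x) * y\<bar> \<le> e1 * \<bar>y\<bar>"
    unfolding eventually_nhds_metric by (auto simp: dist_real_def)
  show ?thesis
  proof (intro exI[of _ "min 1 (min (d0 / 2) d1)"] conjI allI impI)
    show "0 < min 1 (min (d0 / 2) d1)" using d0 d1 by simp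
    fix h :: "'n h1" assume h: "norm h < min 1 (min (d0 / 2) d1)"
    let ?h = "h1_fun h"
    let ?rem = "\<lambda>x. F x (?u x + ?h x) - F x (?u x) - f x (?u x) * ?h x"
    let ?b = "\<lambda>x. e0 * (2 * \<bar>?u x * ?h x\<bar> + \<bar>?h x * ?h x\<bar>) + (if x \<in> A then e1 * norm h else 0)"
    have hx: "\<bar>?h x\<bar> \<le> norm h" for x by (rule h1_fun_le_norm)
    have rem: "\<bar>?rem x\<bar> \<le> ?b x" for x
    proof (cases "x \<in> A")
      case True
      have "\<bar>?rem x\<bar> \<le> e1 * \<bar>?h x\<bar>" using True h hx[of x] by (intro d1) auto
      also have "\<dots> \<le> e1 * norm h" using e1 hx by simp
      finally show ?thesis using True e0 by (simp add: add_increasing)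
    next
      case False
      then have ux: "\<bar>?u x\<bar> < d0 / 2" by (simp add: A_def)
      obtain z where z: "0 < z" "z < 1" "F x (?u x + ?h x) - F x (?u x) = f x (?u x + z * ?h x) * ?h x"
        by (rule F_mean_value)
      have "\<bar>z * ?h x\<bar> \<le> \<bar>?h x\<bar>" using z by (simp add: abs_mult mult_left_le_one_le)
      then have zh: "\<bar>?u x + z * ?h x\<bar> \<le> \<bar>?u x\<bar> + \<bar>?h x\<bar>" by linarith
      have "\<bar>f x (?u x + z * ?h x)\<bar> \<le> e0 * \<bar>?u x + z * ?h x\<bar>"
        using zh ux hx[of x] h by (intro d0) auto
      also have "\<dots> \<le> e0 * (\<bar>?u x\<bar> + \<bar>?h x\<bar>)" using zh e0 by simp
      finally have "\<bar>f x (?u x + z * ?h x)\<bar> \<le> e0 * (\<bar>?u x\<bar> + \<bar>?h x\<bar>)" .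
      moreover have "\<bar>f x (?u x)\<bar> \<le> e0 * \<bar>?u x\<bar>" using ux by (intro d0) auto
      ultimately have "\<bar>f x (?u x + z * ?h x) - f x (?u x)\<bar> \<le> e0 * (2 * \<bar>?u x\<bar> + \<bar>?h x\<bar>)"
        by (simp add: algebra_simps)
      then have "\<bar>f x (?u x + z * ?h x) - f x (?u x)\<bar> * \<bar>?h x\<bar> \<le> e0 * (2 * \<bar>?u x\<bar> + \<bar>?h x\<bar>) * \<bar>?h x\<bar>"
        by (rule mult_right_mono) simp
      moreover have "?rem x = (f x (?u x + z * ?h x) - f x (?u x)) * ?h x"
        using z(3) by (simp add: algebra_simps)
      ultimately show ?thesis using False by (simp only: abs_mult) (simp add: algebra_simps)
    qed
    have s1: "(\<lambda>x. 2 * \<bar>?u x * ?h x\<bar> + \<bar>?h x * ?h x\<bar>) summable_on UNIV"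
      by (intro summable_on_add summable_on_cmult_right h1_abs_mult_summable)
    have s2: "((\<lambda>x. if x \<in> A then e1 * norm h else 0) has_sum (\<Sum>x\<in>A. e1 * norm h)) UNIV"
      by (rule has_sum_finite_neutralI[where B = A]) (auto simp: A)
    have rem_eq: "potential (u + h) - potential u - (\<Sum>\<^sub>\<infinity>x. f x (?u x) * ?h x) = (\<Sum>\<^sub>\<infinity>x. ?rem x)"
      using infsumI[OF has_sum_minus_real[OF has_sum_minus_real[OF
            has_sum_infsum[OF potential_summable[of "u + h"]] has_sum_infsum[OF potential_summable[of u]]]
          has_sum_infsum[OF f_mult_summable[of u h]]]]
      by (simp add: potential_def plus_h1.rep_eq)
    have "\<bar>\<Sum>\<^sub>\<infinity>x. ?rem x\<bar> \<le> infsum ?b UNIV"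
      by (rule summable_on_real_bound(3)[OF _ rem])
        (intro summable_on_add summable_on_cmult_right s1 has_sum_imp_summable[OF s2])
    also have "\<dots> = e0 * (2 * (\<Sum>\<^sub>\<infinity>x. \<bar>?u x * ?h x\<bar>) + (\<Sum>\<^sub>\<infinity>x. \<bar>?h x * ?h x\<bar>)) + real (card A) * (e1 * norm h)"
      unfolding infsum_add[OF summable_on_cmult_right[OF s1] has_sum_imp_summable[OF s2]] infsumI[OF s2]
        infsum_cmult_right' infsum_add[OF summable_on_cmult_right[OF h1_abs_mult_summable] h1_abs_mult_summable]
      by simp
    also have "\<dots> \<le> e0 * (2 * (norm u * norm h) + norm h * norm h) + real (card A) * (e1 * norm h)"
      using e0 by (intro add_right_mono mult_left_mono add_mono h1_Cauchy_Schwarz) auto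
    also have "\<dots> \<le> e / 2 * norm h + e / 2 * norm h"
    proof (rule add_mono)
      have "norm h * norm h \<le> 2 * norm h" using h by (intro mult_right_mono) auto
      then have "e0 * (2 * (norm u * norm h) + norm h * norm h) \<le> e0 * (2 * (norm u + 1) * norm h)"
        using e0 by (intro mult_left_mono) (auto simp: algebra_simps)
      moreover have "e0 * (4 * (norm u + 1)) = e"
      proof -
        have "0 < 4 * (norm u + 1)" by (simp add: add_nonneg_pos)
        then show ?thesis unfolding e0_def by (metis less_irrefl nonzero_mult_div_cancel_right times_divide_eq_left)
      qed
      moreover have "e0 * (2 * (norm u + 1) * norm h) = (e0 * (4 * (norm u + 1))) / 2 * norm h" by simp
      ultimately show "e0 * (2 * (norm u * norm h) + norm h * norm h) \<le> e / 2 * norm h" by (simp only:)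
      have "real (card A) * e1 \<le> e / 2" using e by (simp add: e1_def field_simps)
      then show "real (card A) * (e1 * norm h) \<le> e / 2 * norm h"
        unfolding mult.assoc[symmetric] by (rule mult_right_mono) simp
    qed
    finally show "\<bar>potential (u + h) - potential u - (\<Sum>\<^sub>\<infinity>x. f x (?u x) * ?h x)\<bar> \<le> e * norm h"
      unfolding rem_eq by simp
  qed
qed

text \<open>
  The gradient of the energy for the \<open>\<ell>\<^sup>2\<close> scalar product; its zeros are the solutions of the equation.
\<close>

definition residual :: "'n h1 \<Rightarrow> int^'n \<Rightarrow> real" where
  "residual u x = schroedinger u x - f x (h1_fun u x)"

lemma solves_iff_residual: "solves V f u \<longleftrightarrow> (\<forall>x. residual u x = 0)"
  by (simp add: solves_def residual_def schroedinger_def)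

lemma residual_square_summable: "(\<lambda>x. (residual u x)\<^sup>2) summable_on UNIV"
  using square_summable_add[OF schroedinger_square_summable[of u], of "\<lambda>x. - f x (h1_fun u x)"]
  by (simp add: residual_def f_square_summable)

lemma residual_pairing:
  "(\<Sum>\<^sub>\<infinity>x. residual u x * h1_fun h x)
    = (\<Sum>\<^sub>\<infinity>x. schroedinger u x * h1_fun h x) - (\<Sum>\<^sub>\<infinity>x. f x (h1_fun u x) * h1_fun h x)"
  using infsumI[OF has_sum_minus_real[OF has_sum_infsum[OF schroedinger_mult_summable[of u h]]
      has_sum_infsum[OF f_mult_summable[of u h]]]]
  by (simp add: residual_def left_diff_distrib)

lemma energy_has_derivative: "(E has_derivative (\<lambda>h. \<Sum>\<^sub>\<infinity>x. residual u x * h1_fun h x)) (at u)"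
  unfolding has_derivative_at_alt
proof (intro conjI allI impI)
  show "bounded_linear (\<lambda>h. \<Sum>\<^sub>\<infinity>x. residual u x * h1_fun h x)"
    by (intro bounded_linear_pairing residual_square_summable)
  fix e :: real assume e: "0 < e"
  obtain \<alpha> \<beta> where q: "0 < \<alpha>" "0 < \<beta>" "\<And>u. \<alpha> * (norm u)\<^sup>2 \<le> quad u" "\<And>u. quad u \<le> \<beta> * (norm u)\<^sup>2"
    using quad_bounds by blast
  obtain d where d: "0 < d" "\<And>h. norm h < d \<Longrightarrow>
      \<bar>potential (u + h) - potential u - (\<Sum>\<^sub>\<infinity>x. f x (h1_fun u x) * h1_fun h x)\<bar> \<le> e / 2 * norm h"
    using potential_remainder[of "e / 2" u] e by auto
  show "\<exists>d>0. \<forall>v. norm (v - u) < d \<longrightarrow>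
      norm (E v - E u - (\<Sum>\<^sub>\<infinity>x. residual u x * h1_fun (v - u) x)) \<le> e * norm (v - u)"
  proof (intro exI[of _ "min d (e / \<beta>)"] conjI allI impI)
    show "0 < min d (e / \<beta>)" using d e q by simp
    fix v assume v: "norm (v - u) < min d (e / \<beta>)"
    define h where "h = v - u"
    have "norm h * (\<beta> * norm h) \<le> norm h * e" using v q(2) by (intro mult_left_mono) (auto simp: h_def field_simps)
    then have "quad h \<le> e * norm h" using q(4)[of h] by (simp add: power2_eq_square mult_ac)
    moreover have "0 \<le> quad h"
    proof -
      have "0 \<le> \<alpha> * (norm h)\<^sup>2" using q(1) by simp
      then show ?thesis using q(3)[of h] by linarith
    qed
    moreover have "\<bar>potential (u + h) - potential u - (\<Sum>\<^sub>\<infinity>x. f x (h1_fun u x) * h1_fun h x)\<bar> \<le> e / 2 * norm h"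
      using v by (intro d) (simp add: h_def)
    moreover have "E (u + h) - E u - (\<Sum>\<^sub>\<infinity>x. residual u x * h1_fun h x)
      = 1 / 2 * quad h - (potential (u + h) - potential u - (\<Sum>\<^sub>\<infinity>x. f x (h1_fun u x) * h1_fun h x))"
      by (simp only: energy_split residual_pairing quad_add) (simp add: algebra_simps)
    ultimately have "\<bar>E (u + h) - E u - (\<Sum>\<^sub>\<infinity>x. residual u x * h1_fun h x)\<bar> \<le> e * norm h"
      by linarith
    then show "norm (E v - E u - (\<Sum>\<^sub>\<infinity>x. residual u x * h1_fun (v - u) x)) \<le> e * norm (v - u)"
      by (simp add: h_def)
  qed
qed

lemma critical_point_iff_solves: "critical_point E u \<longleftrightarrow> solves V f u"
proof
  assume "critical_point E u"
  then have "(\<lambda>h. \<Sum>\<^sub>\<infinity>x. residual u x * h1_fun h x) = (\<lambda>_. 0)"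
    unfolding critical_point_def by (rule has_derivative_unique[OF energy_has_derivative])
  moreover have "h1_fun (Abs_h1 (residual u)) = residual u" by (intro h1_fun_Abs residual_square_summable)
  ultimately have z: "(\<Sum>\<^sub>\<infinity>x. residual u x * residual u x) = 0" by metis
  have "residual u x * residual u x = 0" for x
    by (rule nonneg_infsum_le_0D[of "\<lambda>x. residual u x * residual u x" UNIV])
      (use z residual_square_summable[of u] in \<open>auto simp: power2_eq_square\<close>)
  then show "solves V f u" by (simp add: solves_iff_residual)
next
  assume "solves V f u"
  then show "critical_point E u"
    using energy_has_derivative[of u] by (simp add: critical_point_def solves_iff_residual)
qed

section \<open>The Nehari set\<close>

text \<open>
  The sum is the derivative of \<open>E\<close> at \<open>u\<close> in the direction of \<open>u\<close>.
\<close>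

definition nehari :: "'n h1 set" where
  "nehari = {u. u \<noteq> 0 \<and> (\<Sum>\<^sub>\<infinity>x. residual u x * h1_fun u x) = 0}"

lemma quad_nonneg: "0 \<le> quad u"
  unfolding quad_def by (intro infsum_nonneg add_nonneg_nonneg mult_nonneg_nonneg grad_sq_nonneg)
    (auto simp: less_imp_le[OF V_pos])

lemma energy_0: "E 0 = 0"
  using quad_scaleR[of 0 0] by (simp add: energy_split potential_def zero_h1.rep_eq F_0)

text \<open>
  Only the supremum of \<open>u\<close> has to be small, not its norm; this serves both near \<open>0\<close> and for
  sequences that vanish uniformly.
\<close>

lemma potential_small:
  assumes "0 < e"
  shows "\<exists>d>0. \<forall>u. (\<forall>x. \<bar>h1_fun u x\<bar> \<le> d) \<longrightarrow> potential u \<le> e * (norm u)\<^sup>2"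
proof -
  obtain d where d: "0 < d" "\<And>x v. \<bar>v\<bar> \<le> d \<Longrightarrow> \<bar>f x v\<bar> \<le> e * \<bar>v\<bar>"
    using f_little_o[OF assms] by blast
  have "potential u \<le> e * (norm u)\<^sup>2" if u: "\<forall>x. \<bar>h1_fun u x\<bar> \<le> d" for u
  proof -
    have "potential u \<le> (\<Sum>\<^sub>\<infinity>x. e * (h1_fun u x)\<^sup>2)"
      unfolding potential_def
    proof (intro infsum_mono potential_summable summable_on_cmult_right h1_fun_square_summable)
      show "F x (h1_fun u x) \<le> e * (h1_fun u x)\<^sup>2" for x
        by (rule F_le_quadratic[of d]) (use d u assms in auto)
    qed
    also have "\<dots> \<le> e * (norm u)\<^sup>2"
      unfolding infsum_cmult_right' using assms h1_sum_square_le by simp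
    finally show ?thesis .
  qed
  with d(1) show ?thesis by blast
qed

lemma energy_pos_near_0:
  obtains \<rho> \<kappa> where "0 < \<rho>" "0 < \<kappa>" "\<And>u. norm u \<le> \<rho> \<Longrightarrow> \<kappa> * (norm u)\<^sup>2 \<le> E u"
proof -
  obtain \<alpha> \<beta> where q: "0 < \<alpha>" "0 < \<beta>" "\<And>u. \<alpha> * (norm u)\<^sup>2 \<le> quad u" "\<And>u. quad u \<le> \<beta> * (norm u)\<^sup>2"
    using quad_bounds by blast
  obtain d where d: "0 < d" "\<And>u. (\<forall>x. \<bar>h1_fun u x\<bar> \<le> d) \<Longrightarrow> potential u \<le> \<alpha> / 4 * (norm u)\<^sup>2"
    using potential_small[of "\<alpha> / 4"] q(1) by auto
  have "\<alpha> / 4 * (norm u)\<^sup>2 \<le> E u" if "norm u \<le> d" for u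
  proof -
    have "potential u \<le> \<alpha> / 4 * (norm u)\<^sup>2"
      by (rule d(2)) (meson h1_fun_le_norm order_trans that)
    moreover have "\<alpha> / 4 * (norm u)\<^sup>2 + \<alpha> / 4 * (norm u)\<^sup>2 = 1 / 2 * (\<alpha> * (norm u)\<^sup>2)" by simp
    ultimately show ?thesis using q(3)[of u] unfolding energy_split by linarith
  qed
  then show ?thesis using d(1) q(1) by (intro that[of d "\<alpha> / 4"]) auto
qed

text \<open>
  A single vertex where \<open>u\<close> is nonzero suffices: there the superquadratic growth of \<open>F\<close> beats the
  whole quadratic part.
\<close>

lemma energy_ray_eventually_neg:
  assumes "u \<noteq> 0"
  shows "\<exists>M>0. \<forall>t\<ge>M. E (t *\<^sub>R u) < 0"
proof -
  obtain x where x: "h1_fun u x \<noteq> 0" using assms by (rule h1_nonzero_coordinate)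
  define B where "B = quad u / (h1_fun u x)\<^sup>2 + 1"
  obtain K where K: "0 < K" "\<And>x v. K \<le> \<bar>v\<bar> \<Longrightarrow> B * v\<^sup>2 \<le> F x v"
    using F_superquadratic[of B] by blast
  have "E (t *\<^sub>R u) < 0" if t: "K / \<bar>h1_fun u x\<bar> \<le> t" for t
  proof -
    have t0: "0 < t" using t K(1) x by (smt (verit) divide_pos_pos zero_less_abs_iff)
    have "K \<le> \<bar>t * h1_fun u x\<bar>" using t x t0 by (simp add: abs_mult field_simps)
    then have "B * (t * h1_fun u x)\<^sup>2 \<le> F x (t * h1_fun u x)" by (rule K(2))
    also have "\<dots> \<le> potential (t *\<^sub>R u)" using potential_ge_term[of x "t *\<^sub>R u"] by (simp add: scaleR_h1.rep_eq)
    finally have "B * (t * h1_fun u x)\<^sup>2 \<le> potential (t *\<^sub>R u)" .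
    moreover have "B * (t * h1_fun u x)\<^sup>2 = t\<^sup>2 * quad u + t\<^sup>2 * (h1_fun u x)\<^sup>2"
      using x by (simp add: B_def field_simps)
    moreover have "0 < t\<^sup>2 * (h1_fun u x)\<^sup>2" "0 \<le> t\<^sup>2 * quad u" using t0 x quad_nonneg by auto
    ultimately show ?thesis unfolding energy_split quad_scaleR by linarith
  qed
  then show ?thesis using K(1) x by (intro exI[of _ "K / \<bar>h1_fun u x\<bar>"]) auto
qed

text \<open>
  Both parts of \<open>E (t *\<^sub>R u) / t\<^sup>2\<close> are monotone in \<open>t\<close>: the quadratic one is constant and the potential
  one increases by \<open>F_le_square_scaling\<close>.
\<close>

lemma energy_scaling:
  assumes "0 \<le> t" "t \<le> 1"
  shows "t\<^sup>2 * E u \<le> E (t *\<^sub>R u)"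
proof -
  have "potential (t *\<^sub>R u) \<le> t\<^sup>2 * potential u"
    unfolding potential_def infsum_cmult_right'[symmetric]
    by (intro infsum_mono summable_on_cmult_right potential_summable)
      (simp add: scaleR_h1.rep_eq F_le_square_scaling assms)
  then show ?thesis unfolding energy_split quad_scaleR by (simp add: algebra_simps)
qed

text \<open>
  Summing the tangent inequality \<open>F_above_tangent\<close> over the lattice; the Nehari condition turns the
  sum of \<open>f x u * u\<close> into \<open>quad u\<close>, and all quadratic terms cancel.
\<close>

lemma nehari_strict_max:
  assumes u: "u \<in> nehari" and t: "0 \<le> t" "t \<noteq> 1"
  shows "E (t *\<^sub>R u) < E u"
proof -
  let ?u = "h1_fun u"
  let ?P = "\<Sum>\<^sub>\<infinity>x. f x (?u x) * ?u x"
  let ?g = "\<lambda>x. F x (t * ?u x) - F x (?u x) - (t\<^sup>2 - 1) / 2 * (f x (?u x) * ?u x)"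
  have P: "quad u = ?P" using u by (simp add: nehari_def residual_pairing quad_pairing)
  have tu: "((\<lambda>x. F x (t * ?u x)) has_sum potential (t *\<^sub>R u)) UNIV"
    using has_sum_infsum[OF potential_summable[of "t *\<^sub>R u"]] by (simp add: potential_def scaleR_h1.rep_eq)
  have hs: "(?g has_sum (potential (t *\<^sub>R u) - potential u - (t\<^sup>2 - 1) / 2 * ?P)) UNIV"
    unfolding potential_def[of u]
    by (intro has_sum_minus_real has_sum_cmult_right has_sum_infsum potential_summable f_mult_summable tu)
  have g: "0 \<le> ?g x" for x
    using F_above_tangent[of "?u x" t x] t by (cases "?u x = 0") (auto simp: F_0)
  obtain x where x: "?u x \<noteq> 0" using u h1_nonzero_coordinate by (auto simp: nehari_def)
  have "0 < ?g x" using F_above_tangent[OF x t] by simp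
  also have "?g x \<le> infsum ?g UNIV"
    using finite_sum_le_infsum[OF has_sum_imp_summable[OF hs], of "{x}"] g by simp
  also have "\<dots> = potential (t *\<^sub>R u) - potential u - (t\<^sup>2 - 1) / 2 * ?P" by (rule infsumI[OF hs])
  finally show ?thesis unfolding energy_split quad_scaleR P by (simp add: field_simps)
qed

lemma nehari_max: "u \<in> nehari \<Longrightarrow> 0 \<le> t \<Longrightarrow> E (t *\<^sub>R u) \<le> E u"
  using nehari_strict_max[of u t] by (cases "t = 1") auto

lemma energy_continuous: "(g \<longlongrightarrow> u) G \<Longrightarrow> ((\<lambda>n. E (g n)) \<longlongrightarrow> E u) G"
  using isCont_tendsto_compose[OF has_derivative_continuous[OF energy_has_derivative]] .

lemma energy_line_deriv:
  "((\<lambda>t. E (p + t *\<^sub>R h)) has_real_derivative (\<Sum>\<^sub>\<infinity>x. residual (p + t *\<^sub>R h) x * h1_fun h x)) (at t)"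
proof -
  have "((\<lambda>t. p + t *\<^sub>R h) has_derivative (\<lambda>s. s *\<^sub>R h)) (at t)"
    by (auto intro!: derivative_eq_intros)
  from has_derivative_compose[OF this energy_has_derivative]
  show ?thesis
    by (simp add: has_field_derivative_def scaleR_h1.rep_eq mult.left_commute infsum_cmult_right' mult.commute[of _ "infsum _ _"])
qed

text \<open>
  The energy on the ray is positive for small \<open>t > 0\<close> and negative for large \<open>t\<close>, so it has an interior
  maximum, where its derivative vanishes.
\<close>

lemma nehari_ray:
  assumes u: "u \<noteq> 0"
  obtains t where "0 < t" "t *\<^sub>R u \<in> nehari"
proof -
  let ?g = "\<lambda>t. E (t *\<^sub>R u)"
  obtain M where M: "0 < M" "\<And>t. M \<le> t \<Longrightarrow> ?g t < 0" using energy_ray_eventually_neg[OF u] by blast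
  obtain \<rho> \<kappa> where pos: "0 < \<rho>" "0 < \<kappa>" "\<And>u. norm u \<le> \<rho> \<Longrightarrow> \<kappa> * (norm u)\<^sup>2 \<le> E u"
    using energy_pos_near_0 by blast
  have d: "(?g has_real_derivative (\<Sum>\<^sub>\<infinity>x. residual (t *\<^sub>R u) x * h1_fun u x)) (at t)" for t
    using energy_line_deriv[of 0 u t] by simp
  then have "continuous_on {0..M} ?g" by (meson DERIV_isCont continuous_at_imp_continuous_on)
  then obtain m where m: "m \<in> {0..M}" "\<And>t. t \<in> {0..M} \<Longrightarrow> ?g t \<le> ?g m"
    using continuous_attains_sup[of "{0..M}" ?g] M(1) by auto
  define s where "s = min M (\<rho> / norm u)"
  have s: "0 < s" "s \<le> M" using M(1) pos(1) u by (auto simp: s_def)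
  have "norm (s *\<^sub>R u) \<le> \<rho>" using u s(1) by (simp add: s_def min_def field_simps)
  then have "\<kappa> * (norm (s *\<^sub>R u))\<^sup>2 \<le> ?g s" by (rule pos(3))
  moreover have "0 < \<kappa> * (norm (s *\<^sub>R u))\<^sup>2" using pos(2) u s(1) by simp
  ultimately have gm: "0 < ?g m" using m(2)[of s] s by simp
  then have m': "0 < m" "m < M"
    using gm m(1) M(2)[of M] energy_0 by (auto simp: less_le)
  have "(\<Sum>\<^sub>\<infinity>x. residual (m *\<^sub>R u) x * h1_fun u x) = 0"
  proof (rule DERIV_local_max[OF d])
    show "0 < min m (M - m)" using m' by simp
    show "\<forall>y. \<bar>m - y\<bar> < min m (M - m) \<longrightarrow> ?g y \<le> ?g m" using m(2) by (auto simp: abs_if split: if_splits)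
  qed
  then have "m *\<^sub>R u \<in> nehari"
    using u m' by (simp add: nehari_def scaleR_h1.rep_eq mult.left_commute infsum_cmult_right')
  with m'(1) show ?thesis by (rule that)
qed

lemma nehari_nonempty: "nehari \<noteq> {}"
proof -
  have "h1_fun (unit_at 0 :: 'n h1) 0 \<noteq> h1_fun 0 0" by (simp add: h1_fun_unit_at zero_h1.rep_eq)
  then have "unit_at 0 \<noteq> (0 :: 'n h1)" by auto
  then show ?thesis using nehari_ray by blast
qed

definition ground_level :: real where "ground_level = Inf (E ` nehari)"

text \<open>
  A Nehari point has at least the energy of the point of its ray on a small sphere.
\<close>

lemma nehari_energy_bounded_below: "\<exists>m>0. \<forall>u\<in>nehari. m \<le> E u"
proof -
  obtain \<rho> \<kappa> where pos: "0 < \<rho>" "0 < \<kappa>" "\<And>u. norm u \<le> \<rho> \<Longrightarrow> \<kappa> * (norm u)\<^sup>2 \<le> E u"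
    using energy_pos_near_0 by blast
  have "\<kappa> * \<rho>\<^sup>2 \<le> E u" if "u \<in> nehari" for u
  proof -
    have "u \<noteq> 0" using that by (simp add: nehari_def)
    then have n: "norm ((\<rho> / norm u) *\<^sub>R u) = \<rho>" using pos(1) by simp
    then have "\<kappa> * \<rho>\<^sup>2 \<le> E ((\<rho> / norm u) *\<^sub>R u)" using pos(3)[of "(\<rho> / norm u) *\<^sub>R u"] by simp
    also have "\<dots> \<le> E u" using that pos(1) by (intro nehari_max) auto
    finally show ?thesis .
  qed
  then show ?thesis using pos by (intro exI[of _ "\<kappa> * \<rho>\<^sup>2"]) auto
qed

lemma ground_level_le: "u \<in> nehari \<Longrightarrow> ground_level \<le> E u"
  unfolding ground_level_def using nehari_energy_bounded_below
  by (intro cInf_lower) (auto simp: bdd_below_def)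

lemma ground_level_pos: "0 < ground_level"
proof -
  obtain m where "0 < m" "\<And>u. u \<in> nehari \<Longrightarrow> m \<le> E u" using nehari_energy_bounded_below by blast
  moreover from this have "m \<le> ground_level"
    unfolding ground_level_def using nehari_nonempty by (intro cInf_greatest) auto
  ultimately show ?thesis by linarith
qed

lemma nehari_if_solves: "solves V f u \<Longrightarrow> u \<noteq> 0 \<Longrightarrow> u \<in> nehari"
  by (simp add: nehari_def solves_iff_residual)

section \<open>Minimisers on the Nehari set are solutions\<close>

lemma residual_tendsto:
  assumes "(g \<longlongrightarrow> u) G"
  shows "((\<lambda>n. residual (g n) x) \<longlongrightarrow> residual u x) G"
proof -
  have "isCont (f x) (h1_fun u x)" using f_continuous by (simp add: continuous_on_eq_continuous_at)
  then show ?thesis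
    unfolding residual_def schroedinger_def laplacian_def
    by (intro tendsto_intros h1_fun_tendsto assms isCont_tendsto_compose[of _ "f x"])
qed

text \<open>
  If the equation failed at \<open>x\<close>, moving \<open>u\<close> slightly along \<open>\<plusminus> unit_at x\<close> would lower the energy near
  \<open>u\<close>.  The Nehari points \<open>t n *\<^sub>R (u + s n *\<^sub>R h)\<close> on the perturbed rays have \<open>t n \<longlonglongrightarrow> 1\<close> because the
  maximum on the ray of \<open>u\<close> is strict, so they have energy below \<open>E (t n *\<^sub>R u) \<le> E u\<close>.
\<close>

lemma nehari_minimiser_solves:
  assumes u: "u \<in> nehari" and min: "\<And>v. v \<in> nehari \<Longrightarrow> E u \<le> E v"
  shows "solves V f u"
proof (rule ccontr)
  assume "\<not> solves V f u"
  then obtain x where x: "residual u x \<noteq> 0" by (auto simp: solves_iff_residual)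
  define \<sigma> where "\<sigma> = - sgn (residual u x)"
  define h where "h = \<sigma> *\<^sub>R unit_at x"
  have deriv_h: "(\<Sum>\<^sub>\<infinity>y. residual w y * h1_fun h y) = \<sigma> * residual w x" for w
    by (simp add: h_def scaleR_h1.rep_eq mult.left_commute infsum_cmult_right' pairing_unit_at)
  have neg: "\<sigma> * residual u x < 0" using x by (simp add: \<sigma>_def sgn_if)
  have u0: "u \<noteq> 0" using u by (simp add: nehari_def)
  define s where "s n = inverse (real (Suc n))" for n
  have s: "s \<longlonglongrightarrow> 0" "0 < s n" for n
    unfolding s_def[abs_def] using LIMSEQ_inverse_real_of_nat by auto
  define p where "p n = u + s n *\<^sub>R h" for n
  have p: "p \<longlonglongrightarrow> u"
    unfolding p_def using tendsto_add[OF tendsto_const tendsto_scaleR[OF s(1) tendsto_const]] by fastforce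
  have ev_nz: "\<forall>\<^sub>F n in sequentially. p n \<noteq> 0" using tendsto_imp_eventually_ne[OF p u0] .
  define t where "t n = (SOME r. 0 < r \<and> r *\<^sub>R p n \<in> nehari)" for n
  have t: "0 < t n" "t n *\<^sub>R p n \<in> nehari" if "p n \<noteq> 0" for n
    using someI_ex[of "\<lambda>r. 0 < r \<and> r *\<^sub>R p n \<in> nehari"] nehari_ray[OF that] unfolding t_def by blast+
  obtain M where M: "0 < M" "E (M *\<^sub>R u) < 0" using energy_ray_eventually_neg[OF u0] by blast
  have "(\<lambda>n. E (M *\<^sub>R p n)) \<longlonglongrightarrow> E (M *\<^sub>R u)"
    by (intro energy_continuous tendsto_scaleR tendsto_const p)
  then have "\<forall>\<^sub>F n in sequentially. E (M *\<^sub>R p n) < 0" by (rule order_tendstoD) (rule M(2))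
  with ev_nz have "\<forall>\<^sub>F n in sequentially. p n \<noteq> 0 \<and> t n \<in> {0..M}"
  proof eventually_elim
    case (elim n)
    have "t n < M"
    proof (rule ccontr)
      assume "\<not> t n < M"
      then have "(M / t n)\<^sup>2 * E (t n *\<^sub>R p n) \<le> E ((M / t n) *\<^sub>R (t n *\<^sub>R p n))"
        using M(1) t(1)[OF elim(1)] by (intro energy_scaling) auto
      then have "(M / t n)\<^sup>2 * E (t n *\<^sub>R p n) < 0" using elim(2) t(1)[OF elim(1)] by simp
      moreover have "0 < E (t n *\<^sub>R p n)"
        using ground_level_le[OF t(2)[OF elim(1)]] ground_level_pos by linarith
      ultimately show False by (simp add: mult_less_0_iff)
    qed
    then show ?case using t(1)[OF elim(1)] elim(1) by simp
  qed
  then obtain n0 where n0: "\<And>n. n0 \<le> n \<Longrightarrow> p n \<noteq> 0 \<and> t n \<in> {0..M}"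
    by (auto simp: eventually_sequentially)
  have "\<forall>n. t (n + n0) \<in> {0..M}" using n0 by simp
  then obtain l k where k: "strict_mono k" "((\<lambda>n. t (n + n0)) \<circ> k) \<longlonglongrightarrow> l" and l: "l \<in> {0..M}"
    using compact_Icc[of 0 M] unfolding compact_eq_seq_compact_metric seq_compact_def by metis
  define j where "j n = k n + n0" for n
  have j: "filterlim j sequentially sequentially"
    unfolding j_def using filterlim_subseq[OF k(1)]
    by (rule filterlim_at_top_mono) simp
  have tj: "(\<lambda>n. t (j n)) \<longlonglongrightarrow> l" using k(2) by (simp add: j_def o_def)
  have pj: "p (j n) \<noteq> 0" for n using n0[of "j n"] by (simp add: j_def)
  have "(\<lambda>n. E (t (j n) *\<^sub>R p (j n))) \<longlonglongrightarrow> E (l *\<^sub>R u)"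
    by (intro energy_continuous tendsto_scaleR tj filterlim_compose[OF p j])
  then have "E u \<le> E (l *\<^sub>R u)"
    by (rule LIMSEQ_le_const) (use min t pj in blast)
  then have l1: "l = 1" using nehari_strict_max[OF u, of l] l by fastforce
  \<comment> \<open>The energy does not drop from \<open>t (j n) *\<^sub>R u\<close> to the Nehari point on the perturbed ray, so somewhere in between the derivative along \<open>h\<close> is nonnegative.\<close>
  have "\<exists>z\<ge>0. z \<le> t (j n) * s (j n) \<and> 0 \<le> \<sigma> * residual (t (j n) *\<^sub>R u + z *\<^sub>R h) x" for n
  proof -
    let ?b = "t (j n) * s (j n)" and ?q = "t (j n) *\<^sub>R u"
    have b: "0 < ?b" using t(1)[OF pj] s(2) by simp
    obtain z where z: "0 < z" "z < ?b"
      "E (?q + ?b *\<^sub>R h) - E (?q + 0 *\<^sub>R h) = (?b - 0) * (\<Sum>\<^sub>\<infinity>y. residual (?q + z *\<^sub>R h) y * h1_fun h y)"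
      using MVT2[OF b, of "\<lambda>r. E (?q + r *\<^sub>R h)" "\<lambda>r. \<Sum>\<^sub>\<infinity>y. residual (?q + r *\<^sub>R h) y * h1_fun h y"]
        energy_line_deriv by blast
    have "?q + ?b *\<^sub>R h = t (j n) *\<^sub>R p (j n)" by (simp add: p_def scaleR_add_right)
    then have "E u \<le> E (?q + ?b *\<^sub>R h)" using min t(2)[OF pj] by simp
    moreover have "E (?q + 0 *\<^sub>R h) \<le> E u" using nehari_max[OF u, of "t (j n)"] t(1)[OF pj[of n]] by simp
    ultimately have "0 \<le> ?b * (\<sigma> * residual (?q + z *\<^sub>R h) x)" using z(3) unfolding deriv_h by simp
    then have "0 \<le> \<sigma> * residual (?q + z *\<^sub>R h) x" using b by (simp only: zero_le_mult_iff) auto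
    then show ?thesis using z by (intro exI[of _ z]) auto
  qed
  then obtain z where z: "\<And>n. 0 \<le> z n" "\<And>n. z n \<le> t (j n) * s (j n)"
    "\<And>n. 0 \<le> \<sigma> * residual (t (j n) *\<^sub>R u + z n *\<^sub>R h) x" by metis
  have "(\<lambda>n. t (j n) * s (j n)) \<longlonglongrightarrow> l * 0"
    by (intro tendsto_mult tj filterlim_compose[OF s(1) j])
  then have "z \<longlonglongrightarrow> 0"
    by (intro tendsto_sandwich[of "\<lambda>_. 0" z sequentially "\<lambda>n. t (j n) * s (j n)"]) (use z in auto)
  then have "(\<lambda>n. t (j n) *\<^sub>R u + z n *\<^sub>R h) \<longlonglongrightarrow> l *\<^sub>R u + 0 *\<^sub>R h"
    by (intro tendsto_add tendsto_scaleR tj tendsto_const)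
  then have "(\<lambda>n. \<sigma> * residual (t (j n) *\<^sub>R u + z n *\<^sub>R h) x) \<longlonglongrightarrow> \<sigma> * residual u x"
    using l1 by (intro tendsto_mult tendsto_const residual_tendsto) simp
  then have "0 \<le> \<sigma> * residual u x" by (rule LIMSEQ_le_const) (use z in blast)
  with neg show False by simp
qed

section \<open>Compactness up to translations\<close>

lemma energy_shift: "E (shift (\<chi> i. int T * k $ i) u) = E u"
proof -
  let ?z = "\<chi> i. int T * k $ i"
  have V: "V x = V (x + ?z)" for x using periodic_translate[OF V_periodic, of x k] by simp
  have F: "F x v = F (x + ?z) v" for x v
    using periodic_translate[OF f_periodic, of x k] by (simp add: primitive_def)
  have "quad (shift ?z u) = quad u"
    unfolding quad_def grad_sq_shift h1_fun_shift
    by (subst V) (rule infsum_translate[of "\<lambda>x. 1 / 2 * grad_sq (h1_fun u) x + V x * (h1_fun u x)\<^sup>2"])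
  moreover have "potential (shift ?z u) = potential u"
    unfolding potential_def h1_fun_shift
    by (subst F) (rule infsum_translate[of "\<lambda>x. F x (h1_fun u x)"])
  ultimately show ?thesis by (simp add: energy_split)
qed

text \<open>
  A unit vector that is uniformly small has almost no potential energy on bounded multiples, so its
  energy grows like \<open>s\<^sup>2\<close> up to any prescribed level.
\<close>

lemma nonvanishing:
  obtains \<eta> where "0 < \<eta>" "\<And>p. norm p = 1 \<Longrightarrow> (\<And>s. 0 \<le> s \<Longrightarrow> E (s *\<^sub>R p) \<le> b) \<Longrightarrow> \<exists>x. \<eta> \<le> \<bar>h1_fun p x\<bar>"
proof -
  obtain \<alpha> \<beta> where q: "0 < \<alpha>" "0 < \<beta>" "\<And>u. \<alpha> * (norm u)\<^sup>2 \<le> quad u" "\<And>u. quad u \<le> \<beta> * (norm u)\<^sup>2"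
    using quad_bounds by blast
  obtain d where d: "0 < d" "\<And>u. (\<forall>x. \<bar>h1_fun u x\<bar> \<le> d) \<Longrightarrow> potential u \<le> \<alpha> / 4 * (norm u)\<^sup>2"
    using potential_small[of "\<alpha> / 4"] q(1) by auto
  \<comment> \<open>If \<open>p\<close> is uniformly small, \<open>E (s *\<^sub>R p)\<close> is at least \<open>\<alpha> / 4 * s\<^sup>2\<close>, which this \<open>s\<close> puts above \<open>b\<close>.\<close>
  define s where "s = sqrt (4 * (\<bar>b\<bar> + 1) / \<alpha>)"
  have s: "0 < s" "\<alpha> / 4 * s\<^sup>2 = \<bar>b\<bar> + 1" using q(1) by (auto simp: s_def)
  have "\<exists>x. d / s \<le> \<bar>h1_fun p x\<bar>" if p: "norm p = 1" and le: "\<And>s. 0 \<le> s \<Longrightarrow> E (s *\<^sub>R p) \<le> b" for p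
  proof (rule ccontr)
    assume "\<not> (\<exists>x. d / s \<le> \<bar>h1_fun p x\<bar>)"
    then have "\<bar>h1_fun p x\<bar> < d / s" for x by (simp add: not_le)
    then have "\<bar>h1_fun (s *\<^sub>R p) x\<bar> \<le> d" for x
      using s(1) by (simp add: scaleR_h1.rep_eq abs_mult field_simps less_imp_le)
    then have "potential (s *\<^sub>R p) \<le> \<alpha> / 4 * (norm (s *\<^sub>R p))\<^sup>2" by (intro d(2)) blast
    moreover have "\<alpha> * (norm (s *\<^sub>R p))\<^sup>2 \<le> quad (s *\<^sub>R p)" by (rule q(3))
    moreover have "(norm (s *\<^sub>R p))\<^sup>2 = s\<^sup>2" using p by simp
    moreover have "\<alpha> * s\<^sup>2 = 4 * (\<bar>b\<bar> + 1)" using s(2) by simp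
    ultimately have "\<bar>b\<bar> + 1 \<le> E (s *\<^sub>R p)" using s(2) unfolding energy_split by simp
    with le[of s] s(1) show False by simp
  qed
  moreover have "0 < d / s" using d(1) s(1) by simp
  ultimately show ?thesis using that by blast
qed

text \<open>
  The mixed terms in \<open>E (t *\<^sub>R (w + (v n - w)))\<close> are bounded by pairings of the fixed square summable
  functions \<open>schroedinger w\<close> and \<open>w\<close> with the weakly vanishing remainder \<open>v n - w\<close>.
\<close>

lemma energy_splitting:
  fixes v :: "nat \<Rightarrow> 'n h1"
  assumes v: "\<And>n. norm (v n) \<le> K" and lim: "\<And>x. (\<lambda>n. h1_fun (v n) x) \<longlonglongrightarrow> h1_fun w x"
    and R: "0 \<le> R"
  obtains \<omega> where "\<omega> \<longlonglongrightarrow> 0"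
    "\<And>n t. 0 \<le> t \<Longrightarrow> t \<le> R \<Longrightarrow> E (t *\<^sub>R w) + E (t *\<^sub>R (v n - w)) \<le> E (t *\<^sub>R v n) + \<omega> n"
proof -
  define r where "r n = v n - w" for n
  have K: "0 \<le> K" using norm_ge_zero[of "v 0"] v[of 0] by linarith
  have r: "norm (r n) \<le> K + norm w" for n
    using norm_triangle_ineq4[of "v n" w] v[of n] by (simp add: r_def)
  define B where "B = R * (K + norm w)"
  obtain C where C: "0 \<le> C" "\<And>x p r. \<bar>p\<bar> \<le> B \<Longrightarrow> \<bar>r\<bar> \<le> B \<Longrightarrow> \<bar>F x (p + r) - F x p - F x r\<bar> \<le> C * \<bar>p * r\<bar>"
    using F_interaction[of B] by blast
  define \<omega> where "\<omega> n = R\<^sup>2 * ((\<Sum>\<^sub>\<infinity>x. \<bar>schroedinger w x * h1_fun (r n) x\<bar>) + C * (\<Sum>\<^sub>\<infinity>x. \<bar>h1_fun w x * h1_fun (r n) x\<bar>))" for n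
  have r0: "(\<lambda>n. h1_fun (r n) x) \<longlonglongrightarrow> 0" for x
    using tendsto_diff[OF lim tendsto_const, of x "h1_fun w x"] by (simp add: r_def minus_h1.rep_eq)
  have rK: "(\<Sum>\<^sub>\<infinity>x. (h1_fun (r n) x)\<^sup>2) \<le> (K + norm w)\<^sup>2" for n
    using h1_sum_square_le[of "r n"] power_mono[OF r[of n], of 2] by simp
  have "\<omega> \<longlonglongrightarrow> R\<^sup>2 * (0 + C * 0)"
    unfolding \<omega>_def
    by (intro tendsto_mult tendsto_add tendsto_const infsum_abs_pairing_tendsto_0[where w = "\<lambda>n. h1_fun (r n)", OF _ _ rK r0]
        schroedinger_square_summable h1_fun_square_summable)
  then have "\<omega> \<longlonglongrightarrow> 0" by simp
  moreover have "E (t *\<^sub>R w) + E (t *\<^sub>R (v n - w)) \<le> E (t *\<^sub>R v n) + \<omega> n" if t: "0 \<le> t" "t \<le> R" for t n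
  proof -
    let ?w = "h1_fun w" and ?r = "h1_fun (r n)"
    have vn: "v n = w + r n" by (simp add: r_def)
    have sS: "(\<lambda>x. \<bar>schroedinger w x * ?r x\<bar>) summable_on UNIV"
      using square_summable_prod[of "\<lambda>x. \<bar>schroedinger w x\<bar>" UNIV "\<lambda>x. \<bar>?r x\<bar>"]
      by (simp add: abs_mult schroedinger_square_summable h1_fun_square_summable)
    have S: "\<bar>\<Sum>\<^sub>\<infinity>x. schroedinger w x * ?r x\<bar> \<le> (\<Sum>\<^sub>\<infinity>x. \<bar>schroedinger w x * ?r x\<bar>)"
      by (rule summable_on_real_bound(3)[OF sS]) simp
    have bound: "\<bar>t * h1_fun u x\<bar> \<le> B" if "norm u \<le> K + norm w" for u x
    proof -
      have "\<bar>h1_fun u x\<bar> \<le> K + norm w" using h1_fun_le_norm[of u x] that by linarith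
      then have "t * \<bar>h1_fun u x\<bar> \<le> R * (K + norm w)" using t R by (intro mult_mono) auto
      then show ?thesis using t by (simp add: abs_mult B_def)
    qed
    let ?d = "\<lambda>x. F x (t * ?w x + t * ?r x) - F x (t * ?w x) - F x (t * ?r x)"
    have d: "\<bar>?d x\<bar> \<le> (C * t\<^sup>2) * \<bar>?w x * ?r x\<bar>" for x
    proof -
      have "\<bar>?d x\<bar> \<le> C * \<bar>(t * ?w x) * (t * ?r x)\<bar>" by (intro C(2) bound r) (use K in simp)
      also have "\<dots> = (C * t\<^sup>2) * \<bar>?w x * ?r x\<bar>" using t by (simp add: abs_mult power2_eq_square)
      finally show ?thesis .
    qed
    have ds: "(?d has_sum (potential (t *\<^sub>R v n) - potential (t *\<^sub>R w) - potential (t *\<^sub>R r n))) UNIV"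
      using has_sum_minus_real[OF has_sum_minus_real[OF
            has_sum_infsum[OF potential_summable[of "t *\<^sub>R v n"]] has_sum_infsum[OF potential_summable[of "t *\<^sub>R w"]]]
          has_sum_infsum[OF potential_summable[of "t *\<^sub>R r n"]]]
      by (simp add: potential_def vn scaleR_h1.rep_eq plus_h1.rep_eq distrib_left)
    have "\<bar>potential (t *\<^sub>R v n) - potential (t *\<^sub>R w) - potential (t *\<^sub>R r n)\<bar> \<le> (C * t\<^sup>2) * (\<Sum>\<^sub>\<infinity>x. \<bar>?w x * ?r x\<bar>)"
      using summable_on_real_bound(3)[OF summable_on_cmult_right[OF h1_abs_mult_summable] d]
      by (simp only: infsumI[OF ds] infsum_cmult_right')
    moreover have "quad (t *\<^sub>R v n) = quad (t *\<^sub>R w) + quad (t *\<^sub>R r n) + 2 * (t\<^sup>2 * (\<Sum>\<^sub>\<infinity>x. schroedinger w x * ?r x))"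
      unfolding vn quad_scaleR quad_add by (simp add: algebra_simps)
    moreover have "t\<^sup>2 * \<bar>\<Sum>\<^sub>\<infinity>x. schroedinger w x * ?r x\<bar> + (C * t\<^sup>2) * (\<Sum>\<^sub>\<infinity>x. \<bar>?w x * ?r x\<bar>) \<le> \<omega> n"
    proof -
      have "t\<^sup>2 * (\<bar>\<Sum>\<^sub>\<infinity>x. schroedinger w x * ?r x\<bar> + C * (\<Sum>\<^sub>\<infinity>x. \<bar>?w x * ?r x\<bar>)) \<le> \<omega> n"
        unfolding \<omega>_def using t C(1) S
        by (intro mult_mono add_mono power_mono add_nonneg_nonneg mult_nonneg_nonneg infsum_nonneg) auto
      then show ?thesis by (simp add: algebra_simps)
    qed
    moreover have "t\<^sup>2 * - \<bar>\<Sum>\<^sub>\<infinity>x. schroedinger w x * ?r x\<bar> \<le> t\<^sup>2 * (\<Sum>\<^sub>\<infinity>x. schroedinger w x * ?r x)"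
      by (rule mult_left_mono) simp_all
    ultimately show ?thesis unfolding energy_split r_def[symmetric] by linarith
  qed
  ultimately show ?thesis using that by blast
qed

section \<open>The ground level is attained\<close>

text \<open>
  Normalised and translated minimising sequence: translations by periods bring a point where
  \<open>v n\<close> is not small into the fixed finite period_cell, so the pointwise limit is nonzero.
\<close>

lemma minimising_profile:
  obtains v w where "\<And>n. norm (v n) = 1" "\<And>x. (\<lambda>n. h1_fun (v n) x) \<longlonglongrightarrow> h1_fun w x" "w \<noteq> 0"
    "\<And>n t. 0 \<le> t \<Longrightarrow> E (t *\<^sub>R v n) \<le> ground_level + inverse (real (Suc n))"
proof -
  have "\<exists>u\<in>nehari. E u < ground_level + inverse (real (Suc n))" for n
  proof -
    have "Inf (E ` nehari) < ground_level + inverse (real (Suc n))" by (simp add: ground_level_def)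
    then obtain y where "y \<in> E ` nehari" "y < ground_level + inverse (real (Suc n))"
      using cInf_lessD[of "E ` nehari"] nehari_nonempty by blast
    then show ?thesis by blast
  qed
  then obtain u where u: "\<And>n. u n \<in> nehari" "\<And>n. E (u n) < ground_level + inverse (real (Suc n))" by metis
  define p where "p n = u n /\<^sub>R norm (u n)" for n
  have u0: "u n \<noteq> 0" for n using u(1)[of n] by (simp add: nehari_def)
  have p1: "norm (p n) = 1" for n using u0[of n] by (simp add: p_def)
  have pE: "E (t *\<^sub>R p n) \<le> ground_level + inverse (real (Suc n))" if "0 \<le> t" for t n
  proof -
    have "E ((t / norm (u n)) *\<^sub>R u n) \<le> E (u n)" using that by (intro nehari_max u) simp
    then show ?thesis using u(2)[of n] by (simp add: p_def divide_inverse)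
  qed
  obtain \<eta> where \<eta>: "0 < \<eta>" "\<And>p. norm p = 1 \<Longrightarrow> (\<And>s. 0 \<le> s \<Longrightarrow> E (s *\<^sub>R p) \<le> ground_level + 1) \<Longrightarrow> \<exists>x. \<eta> \<le> \<bar>h1_fun p x\<bar>"
    using nonvanishing[of "ground_level + 1"] by blast
  have "\<exists>x. \<eta> \<le> \<bar>h1_fun (p n) x\<bar>" for n
  proof (rule \<eta>(2)[OF p1])
    fix s :: real assume "0 \<le> s"
    then have "E (s *\<^sub>R p n) \<le> ground_level + inverse (real (Suc n))" by (rule pE)
    also have "\<dots> \<le> ground_level + 1" by (simp add: field_simps)
    finally show "E (s *\<^sub>R p n) \<le> ground_level + 1" .
  qed
  then obtain y where y: "\<And>n. \<eta> \<le> \<bar>h1_fun (p n) (y n)\<bar>" by metis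
  have "\<forall>n. \<exists>k. y n + (\<chi> i. int T * k $ i) \<in> period_cell" using translate_into_period_cell by blast
  from choice[OF this] obtain k where k: "\<And>n. y n + (\<chi> i. int T * k n $ i) \<in> period_cell" by blast
  define z where "z n = (\<chi> i. int T * (- k n) $ i)" for n
  define v' where "v' n = shift (z n) (p n)" for n
  have v'1: "norm (v' n) = 1" for n by (simp add: v'_def norm_shift p1)
  have v'E: "E (t *\<^sub>R v' n) \<le> ground_level + inverse (real (Suc n))" if "0 \<le> t" for t n
    using pE[OF that, of n] energy_shift[of "- k n" "t *\<^sub>R p n"] by (simp only: v'_def z_def shift_scaleR)
  have v'period_cell: "\<eta>\<^sup>2 \<le> (\<Sum>x\<in>period_cell. (h1_fun (v' n) x)\<^sup>2)" for n
  proof -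
    let ?x = "y n + (\<chi> i. int T * k n $ i)"
    have "?x + z n = y n" by (simp add: z_def vec_eq_iff)
    then have "h1_fun (v' n) ?x = h1_fun (p n) (y n)" by (simp only: v'_def h1_fun_shift)
    then have "\<eta>\<^sup>2 \<le> (h1_fun (v' n) ?x)\<^sup>2" using y[of n] \<eta>(1) power_mono[of \<eta> "\<bar>h1_fun (p n) (y n)\<bar>" 2] by simp
    also have "\<dots> \<le> (\<Sum>x\<in>period_cell. (h1_fun (v' n) x)\<^sup>2)" by (intro member_le_sum k finite_period_cell) auto
    finally show ?thesis .
  qed
  obtain j w where j: "strict_mono j" "\<And>x. (\<lambda>n. h1_fun (v' (j n)) x) \<longlonglongrightarrow> h1_fun w x"
    using bounded_pointwise_subsequence[of v' 1] v'1 by auto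
  have "(\<lambda>n. \<Sum>x\<in>period_cell. (h1_fun (v' (j n)) x)\<^sup>2) \<longlonglongrightarrow> (\<Sum>x\<in>period_cell. (h1_fun w x)\<^sup>2)"
    by (intro tendsto_intros j)
  then have "\<eta>\<^sup>2 \<le> (\<Sum>x\<in>period_cell. (h1_fun w x)\<^sup>2)" by (rule LIMSEQ_le_const) (use v'period_cell in blast)
  then have "w \<noteq> 0" using \<eta>(1) by (auto simp: zero_h1.rep_eq)
  moreover have "E (t *\<^sub>R v' (j n)) \<le> ground_level + inverse (real (Suc n))" if "0 \<le> t" for t n
  proof -
    have "inverse (real (Suc (j n))) \<le> inverse (real (Suc n))"
      using seq_suble[OF j(1), of n] by (intro le_imp_inverse_le) auto
    then show ?thesis using v'E[OF that, of "j n"] by linarith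
  qed
  ultimately show ?thesis using v'1 j(2) by (intro that[of "\<lambda>n. v' (j n)" w]) auto
qed

text \<open>
  The limit profile carries the whole energy.  Otherwise the energy of \<open>w\<close> on its ray exceeds the
  ground level, so the remainder has negative energy at the same parameter \<open>\<tau>\<close> and reaches the
  Nehari set already at some \<open>t < \<tau>\<close>.  There it uses up the ground level alone.  This leaves almost no
  energy for \<open>t *\<^sub>R w\<close>, so that \<open>t\<close> is small; but then \<open>t *\<^sub>R (v n - w)\<close> is too small to have the energy of
  a Nehari point.
\<close>

lemma ground_level_attained: obtains u where "u \<in> nehari" "E u = ground_level"
proof -
  obtain v w where v: "\<And>n. norm (v n) = 1" "\<And>x. (\<lambda>n. h1_fun (v n) x) \<longlonglongrightarrow> h1_fun w x"
    and w: "w \<noteq> 0"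
    and vE: "\<And>n t. 0 \<le> t \<Longrightarrow> E (t *\<^sub>R v n) \<le> ground_level + inverse (real (Suc n))"
    using minimising_profile by blast
  obtain \<tau> where \<tau>: "0 < \<tau>" "\<tau> *\<^sub>R w \<in> nehari" using nehari_ray[OF w] .
  obtain \<omega> where \<omega>: "\<omega> \<longlonglongrightarrow> 0"
    "\<And>n t. 0 \<le> t \<Longrightarrow> t \<le> \<tau> \<Longrightarrow> E (t *\<^sub>R w) + E (t *\<^sub>R (v n - w)) \<le> E (t *\<^sub>R v n) + \<omega> n"
    using energy_splitting[of v 1 w \<tau>] v \<tau>(1) by (auto simp: less_imp_le)
  obtain \<alpha> \<beta> where q: "0 < \<alpha>" "0 < \<beta>" "\<And>u. \<alpha> * (norm u)\<^sup>2 \<le> quad u" "\<And>u. quad u \<le> \<beta> * (norm u)\<^sup>2"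
    using quad_bounds by blast
  note c = ground_level_pos
  define \<epsilon> where "\<epsilon> n = inverse (real (Suc n)) + \<omega> n" for n
  have \<epsilon>: "\<epsilon> \<longlonglongrightarrow> 0" unfolding \<epsilon>_def using tendsto_add[OF LIMSEQ_inverse_real_of_nat \<omega>(1)] by simp
  have "\<not> ground_level < E (\<tau> *\<^sub>R w)"
  proof
    assume gap: "ground_level < E (\<tau> *\<^sub>R w)"
    define D where "D = \<beta> * (1 + norm w)\<^sup>2"
    have "0 < 1 + norm w" by (simp add: add_pos_nonneg)
    then have D: "0 < D" using q(2) by (simp add: D_def)
    have ev1: "\<forall>\<^sub>F n in sequentially. \<epsilon> n < E (\<tau> *\<^sub>R w) - ground_level"
      using \<epsilon> by (rule order_tendstoD) (use gap in simp)
    have ev2: "\<forall>\<^sub>F n in sequentially. \<epsilon> n < 2 * ground_level / (D * \<tau>\<^sup>2) * ground_level"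
      using \<epsilon> by (rule order_tendstoD) (use c D \<tau>(1) in simp)
    \<comment> \<open>The two bounds on the error say that \<open>v n - w\<close> has negative energy at \<open>\<tau>\<close>, and that the lower bound on \<open>t / \<tau>\<close> obtained below is violated.\<close>
    from eventually_conj[OF ev1 ev2] obtain n where n: "\<epsilon> n < E (\<tau> *\<^sub>R w) - ground_level"
      "\<epsilon> n < 2 * ground_level / (D * \<tau>\<^sup>2) * ground_level"
      by (auto simp: eventually_sequentially)
    define r where "r = v n - w"
    have split: "E (t *\<^sub>R w) + E (t *\<^sub>R r) \<le> ground_level + \<epsilon> n" if "0 \<le> t" "t \<le> \<tau>" for t
      using \<omega>(2)[OF that, of n] vE[OF that(1), of n] by (simp add: r_def \<epsilon>_def)
    have neg: "E (\<tau> *\<^sub>R r) < 0" using split[of \<tau>] \<tau>(1) n(1) by simp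
    have r0: "r \<noteq> 0"
    proof
      assume "r = 0"
      with neg show False by (simp add: energy_0)
    qed
    obtain t where t: "0 < t" "t *\<^sub>R r \<in> nehari" using nehari_ray[OF r0] .
    have level: "ground_level \<le> E (t *\<^sub>R r)" by (rule ground_level_le[OF t(2)])
    have t\<tau>: "t < \<tau>"
    proof (rule ccontr)
      assume "\<not> t < \<tau>"
      then have "(\<tau> / t)\<^sup>2 * E (t *\<^sub>R r) \<le> E ((\<tau> / t) *\<^sub>R (t *\<^sub>R r))"
        using \<tau>(1) t(1) by (intro energy_scaling) auto
      then have "(\<tau> / t)\<^sup>2 * E (t *\<^sub>R r) < 0" using neg t(1) by simp
      then show False using level c by (simp add: mult_less_0_iff)
    qed
    have "(t / \<tau>)\<^sup>2 * ground_level \<le> (t / \<tau>)\<^sup>2 * E (\<tau> *\<^sub>R w)"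
      by (intro mult_left_mono ground_level_le \<tau>) simp
    also have "\<dots> \<le> E ((t / \<tau>) *\<^sub>R (\<tau> *\<^sub>R w))" using t t\<tau> \<tau>(1) by (intro energy_scaling) auto
    also have "\<dots> = E (t *\<^sub>R w)" using \<tau>(1) by simp
    also have "\<dots> \<le> \<epsilon> n" using split[of t] t(1) t\<tau> level by simp
    finally have upper: "(t / \<tau>)\<^sup>2 * ground_level \<le> \<epsilon> n" .
    have "norm r \<le> 1 + norm w" using norm_triangle_ineq4[of "v n" w] v(1)[of n] by (simp add: r_def)
    then have "\<beta> * (norm r)\<^sup>2 \<le> D" unfolding D_def using q(2) by (intro mult_left_mono power_mono) auto
    then have "quad r \<le> D" using q(4)[of r] by linarith
    then have "t\<^sup>2 * quad r \<le> t\<^sup>2 * D" by (intro mult_left_mono) auto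
    then have "2 * ground_level \<le> t\<^sup>2 * D"
      using level potential_nonneg[of "t *\<^sub>R r"] unfolding energy_split quad_scaleR by linarith
    then have "2 * ground_level / (D * \<tau>\<^sup>2) \<le> (t / \<tau>)\<^sup>2"
      using D \<tau>(1) by (simp add: power_divide field_simps)
    then have "2 * ground_level / (D * \<tau>\<^sup>2) * ground_level \<le> (t / \<tau>)\<^sup>2 * ground_level"
      using c by (intro mult_right_mono) auto
    with upper n(2) show False by linarith
  qed
  then have "E (\<tau> *\<^sub>R w) = ground_level" using ground_level_le[OF \<tau>(2)] by linarith
  with \<tau>(2) show ?thesis by (rule that)
qed

theorem ground_state_exists: "\<exists>u. ground_state V f u"
proof -
  obtain u where u: "u \<in> nehari" "E u = ground_level" by (rule ground_level_attained)
  have "solves V f u" by (rule nehari_minimiser_solves[OF u(1)]) (simp add: u(2) ground_level_le)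
  moreover have "E u \<le> E v" if "critical_point E v" "0 < E v" for v
  proof -
    have "v \<noteq> 0" using that(2) energy_0 by auto
    then have "v \<in> nehari" using that(1) by (simp add: critical_point_iff_solves nehari_if_solves)
    then show ?thesis using u(2) ground_level_le by simp
  qed
  ultimately have "ground_state V f u"
    using u(2) ground_level_pos by (simp add: ground_state_def critical_point_iff_solves)
  then show ?thesis by blast
qed

end

theorem theorem1p1:
  fixes T :: nat
    and V :: "int^'n \<Rightarrow> real"
    and f :: "int^'n \<Rightarrow> real \<Rightarrow> real"
    and a q :: real
  assumes "T \<ge> 1"
    and "\<And>x. continuous_on UNIV (f x)"
    and "a > 0" and "q > 2"
    and "\<And>x u. \<bar>f x u\<bar> \<le> a * (\<bar>u\<bar> + \<bar>u\<bar> powr (q - 1))"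
    and "periodic T V" and "\<And>u. periodic T (\<lambda>x. f x u)" and "\<And>x. V x > 0"
    and "uniform_limit UNIV (\<lambda>u x. f x u / u) (\<lambda>_. 0) (at 0)"
    and "\<And>x. strict_mono_on {..<0} (\<lambda>u. f x u / \<bar>u\<bar>)"
    and "\<And>x. strict_mono_on {0<..} (\<lambda>u. f x u / \<bar>u\<bar>)"
    and "\<And>B. \<forall>\<^sub>F u in at_infinity. \<forall>x. primitive f x u / u\<^sup>2 \<ge> B"
  shows "\<exists>u. ground_state V f u"
proof -
  interpret periodic_superlinear T V f a q
    by unfold_locales (fact assms)+
  show ?thesis by (rule ground_state_exists)
qed

end
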